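(* The lattice $\mathcal L_o(\mathsf{NOCR})$ is isomorphic to the direct product of the lattices $\mathcal L_o(\mathsf{NB})$ and $\mathcal L(\mathsf G)$.
   Context: An ordered semigroup is a semigroup with a partial order $\le$ that is stable ($s\le t$ implies $as\le at$ and $sa\le ta$). Homomorphisms of ordered semigroups are isotone semigroup homomorphisms. A pseudovariety of ordered semigroups is a class of finite ordered semigroups closed under homomorphic images, ordered subsemigroups (with the induced order) and finite direct products (with the product order). A pseudovariety of semigroups is a class of finite semigroups closed under homomorphic images, subsemigroups and finite direct products. A pseudovariety of semigroups is identified with the pseudovariety of ordered semigroups consisting of all its members equipped with every possible stable partial order. $\mathcal L_o(\mathsf U)$ is the lattice (under inclusion) of all pseudovarieties of ordered semigroups contained in $\mathsf U$; $\mathcal L(\mathsf U)$ is the lattice of all pseudovarieties of semigroups contained in $\mathsf U$. $\mathsf G$ is the pseudovariety of all finite groups; $\mathsf{NB}$ is that of all finite normal bands (semigroups satisfying $x^2=x$ and $xyzx=xzyx$); $\mathsf{NOCR}$ is that of all finite normal orthogroups, that is, finite completely regular semigroups (every element lies in a subgroup) whose idempotents form a subsemigroup that is a normal band. *)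

theory Defs
  imports "HOL-Algebra.Group"
begin

section \<open>Semigroups and ordered semigroups on explicit carriers\<close>

record 'a semigrp = "'a partial_object" +
  sg_mult :: "'a \<Rightarrow> 'a \<Rightarrow> 'a" (infixl \<open>\<bullet>\<index>\<close> 70)

record 'a ord_semigrp = "'a semigrp" +
  sg_le :: "'a \<Rightarrow> 'a \<Rightarrow> bool" (infix \<open>\<preceq>\<index>\<close> 50)

text \<open>Only the restrictions of \<open>sg_mult\<close> and \<open>sg_le\<close> to the carrier are meaningful.
  As usual in the theory of pseudovarieties, semigroups are nonempty.\<close>

definition semigroup_str :: "('a, 'm) semigrp_scheme \<Rightarrow> bool" where
  "semigroup_str S \<longleftrightarrow> carrier S \<noteq> {} \<and>
     (\<forall>x \<in> carrier S. \<forall>y \<in> carrier S. x \<bullet>\<^bsub>S\<^esub> y \<in> carrier S) \<and>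
     (\<forall>x \<in> carrier S. \<forall>y \<in> carrier S. \<forall>z \<in> carrier S.
        (x \<bullet>\<^bsub>S\<^esub> y) \<bullet>\<^bsub>S\<^esub> z = x \<bullet>\<^bsub>S\<^esub> (y \<bullet>\<^bsub>S\<^esub> z))"

definition ord_semigroup_str :: "('a, 'm) ord_semigrp_scheme \<Rightarrow> bool" where
  "ord_semigroup_str S \<longleftrightarrow> semigroup_str S \<and>
     reflp_on (carrier S) (sg_le S) \<and> antisymp_on (carrier S) (sg_le S) \<and>
     transp_on (carrier S) (sg_le S) \<and>
     (\<forall>s \<in> carrier S. \<forall>t \<in> carrier S. \<forall>a \<in> carrier S.
        s \<preceq>\<^bsub>S\<^esub> t \<longrightarrow> a \<bullet>\<^bsub>S\<^esub> s \<preceq>\<^bsub>S\<^esub> a \<bullet>\<^bsub>S\<^esub> t \<and> s \<bullet>\<^bsub>S\<^esub> a \<preceq>\<^bsub>S\<^esub> t \<bullet>\<^bsub>S\<^esub> a)"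

definition finite_semigroup :: "('a, 'm) semigrp_scheme \<Rightarrow> bool" where
  "finite_semigroup S \<longleftrightarrow> semigroup_str S \<and> finite (carrier S)"

definition finite_ord_semigroup :: "('a, 'm) ord_semigrp_scheme \<Rightarrow> bool" where
  "finite_ord_semigroup S \<longleftrightarrow> ord_semigroup_str S \<and> finite (carrier S)"

definition sg_hom :: "('a, 'm) semigrp_scheme \<Rightarrow> ('b, 'n) semigrp_scheme \<Rightarrow> ('a \<Rightarrow> 'b) set" where
  "sg_hom S T = {h \<in> carrier S \<rightarrow> carrier T.
     \<forall>x \<in> carrier S. \<forall>y \<in> carrier S. h (x \<bullet>\<^bsub>S\<^esub> y) = h x \<bullet>\<^bsub>T\<^esub> h y}"

definition osg_hom :: "('a, 'm) ord_semigrp_scheme \<Rightarrow> ('b, 'n) ord_semigrp_scheme \<Rightarrow> ('a \<Rightarrow> 'b) set" where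
  "osg_hom S T = {h \<in> sg_hom S T.
     \<forall>x \<in> carrier S. \<forall>y \<in> carrier S. x \<preceq>\<^bsub>S\<^esub> y \<longrightarrow> h x \<preceq>\<^bsub>T\<^esub> h y}"

definition sg_iso :: "('a, 'm) semigrp_scheme \<Rightarrow> ('b, 'n) semigrp_scheme \<Rightarrow> ('a \<Rightarrow> 'b) set" where
  "sg_iso S T = {h \<in> sg_hom S T. bij_betw h (carrier S) (carrier T)}"

text \<open>A bijective isotone homomorphism need not have an isotone inverse, so the order has
  to be reflected explicitly.\<close>

definition osg_iso :: "('a, 'm) ord_semigrp_scheme \<Rightarrow> ('b, 'n) ord_semigrp_scheme \<Rightarrow> ('a \<Rightarrow> 'b) set" where
  "osg_iso S T = {h \<in> sg_iso S T.
     \<forall>x \<in> carrier S. \<forall>y \<in> carrier S. x \<preceq>\<^bsub>S\<^esub> y \<longleftrightarrow> h x \<preceq>\<^bsub>T\<^esub> h y}"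

definition subsemigroup :: "'a set \<Rightarrow> ('a, 'm) semigrp_scheme \<Rightarrow> bool" where
  "subsemigroup A S \<longleftrightarrow> A \<noteq> {} \<and> A \<subseteq> carrier S \<and> (\<forall>x \<in> A. \<forall>y \<in> A. x \<bullet>\<^bsub>S\<^esub> y \<in> A)"

definition sg_prod :: "'i set \<Rightarrow> ('i \<Rightarrow> ('a, 'm) semigrp_scheme) \<Rightarrow> ('i \<Rightarrow> 'a) semigrp" where
  "sg_prod I S = \<lparr> carrier = (\<Pi>\<^sub>E i \<in> I. carrier (S i)),
                   sg_mult = (\<lambda>x y. \<lambda>i \<in> I. x i \<bullet>\<^bsub>S i\<^esub> y i) \<rparr>"

definition osg_prod :: "'i set \<Rightarrow> ('i \<Rightarrow> ('a, 'm) ord_semigrp_scheme) \<Rightarrow> ('i \<Rightarrow> 'a) ord_semigrp" where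
  "osg_prod I S = \<lparr> carrier = (\<Pi>\<^sub>E i \<in> I. carrier (S i)),
                    sg_mult = (\<lambda>x y. \<lambda>i \<in> I. x i \<bullet>\<^bsub>S i\<^esub> y i),
                    sg_le = (\<lambda>x y. \<forall>i \<in> I. x i \<preceq>\<^bsub>S i\<^esub> y i) \<rparr>"


section \<open>Pseudovarieties\<close>

text \<open>Every finite (ordered) semigroup is isomorphic to one whose carrier is a set of natural
  numbers, and pseudovarieties are closed under isomorphism (a special case of homomorphic
  images). A class of finite (ordered) semigroups is therefore represented by the set of its
  members carried by sets of natural numbers. A direct product of members has to be transported
  back to such a carrier along an isomorphism. The empty product (\<open>n = 0\<close>) is included, so a
  pseudovariety always contains the trivial semigroups and is nonempty.\<close>

definition pseudovariety :: "nat semigrp set \<Rightarrow> bool" where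
  "pseudovariety V \<longleftrightarrow>
     (\<forall>S \<in> V. finite_semigroup S) \<and>
     (\<forall>S \<in> V. \<forall>T :: nat semigrp. \<forall>h. finite_semigroup T \<and> h \<in> sg_hom S T \<and>
        h ` carrier S = carrier T \<longrightarrow> T \<in> V) \<and>
     (\<forall>S \<in> V. \<forall>A. subsemigroup A S \<longrightarrow> S\<lparr>carrier := A\<rparr> \<in> V) \<and>
     (\<forall>n :: nat. \<forall>S. \<forall>T :: nat semigrp. (\<forall>i < n. S i \<in> V) \<and> finite_semigroup T \<and>
        sg_iso (sg_prod {..<n} S) T \<noteq> {} \<longrightarrow> T \<in> V)"

definition ord_pseudovariety :: "nat ord_semigrp set \<Rightarrow> bool" where
  "ord_pseudovariety V \<longleftrightarrow>
     (\<forall>S \<in> V. finite_ord_semigroup S) \<and>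
     (\<forall>S \<in> V. \<forall>T :: nat ord_semigrp. \<forall>h. finite_ord_semigroup T \<and> h \<in> osg_hom S T \<and>
        h ` carrier S = carrier T \<longrightarrow> T \<in> V) \<and>
     (\<forall>S \<in> V. \<forall>A. subsemigroup A S \<longrightarrow> S\<lparr>carrier := A\<rparr> \<in> V) \<and>
     (\<forall>n :: nat. \<forall>S. \<forall>T :: nat ord_semigrp. (\<forall>i < n. S i \<in> V) \<and> finite_ord_semigroup T \<and>
        osg_iso (osg_prod {..<n} S) T \<noteq> {} \<longrightarrow> T \<in> V)"

text \<open>The class of all ordered semigroups whose semigroup reduct (\<open>semigrp.truncate\<close>) lies in
  \<open>U\<close>. This identifies a pseudovariety of semigroups with a pseudovariety of ordered
  semigroups.\<close>

definition with_all_orders :: "nat semigrp set \<Rightarrow> nat ord_semigrp set" where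
  "with_all_orders U = {S. finite_ord_semigroup S \<and> semigrp.truncate S \<in> U}"

definition pv_lattice :: "nat semigrp set \<Rightarrow> nat semigrp set gorder" (\<open>\<L>\<close>) where
  "\<L> U = \<lparr> carrier = {V. pseudovariety V \<and> V \<subseteq> U}, eq = (=), le = (\<subseteq>) \<rparr>"

definition ord_pv_lattice :: "nat semigrp set \<Rightarrow> nat ord_semigrp set gorder" (\<open>\<L>\<^sub>o\<close>) where
  "\<L>\<^sub>o U = \<lparr> carrier = {V. ord_pseudovariety V \<and> V \<subseteq> with_all_orders U}, eq = (=), le = (\<subseteq>) \<rparr>"


section \<open>Groups, normal bands and normal orthogroups\<close>

definition group_on :: "('a, 'm) semigrp_scheme \<Rightarrow> 'a set \<Rightarrow> bool" where
  "group_on S H \<longleftrightarrow> H \<subseteq> carrier S \<and> (\<exists>e. group \<lparr> carrier = H, monoid.mult = sg_mult S, one = e \<rparr>)"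

definition normal_band :: "('a, 'm) semigrp_scheme \<Rightarrow> bool" where
  "normal_band S \<longleftrightarrow> semigroup_str S \<and>
     (\<forall>x \<in> carrier S. x \<bullet>\<^bsub>S\<^esub> x = x) \<and>
     (\<forall>x \<in> carrier S. \<forall>y \<in> carrier S. \<forall>z \<in> carrier S.
        x \<bullet>\<^bsub>S\<^esub> y \<bullet>\<^bsub>S\<^esub> z \<bullet>\<^bsub>S\<^esub> x = x \<bullet>\<^bsub>S\<^esub> z \<bullet>\<^bsub>S\<^esub> y \<bullet>\<^bsub>S\<^esub> x)"

definition idempotents :: "('a, 'm) semigrp_scheme \<Rightarrow> 'a set" where
  "idempotents S = {x \<in> carrier S. x \<bullet>\<^bsub>S\<^esub> x = x}"

definition completely_regular :: "('a, 'm) semigrp_scheme \<Rightarrow> bool" where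
  "completely_regular S \<longleftrightarrow> semigroup_str S \<and> (\<forall>x \<in> carrier S. \<exists>H. group_on S H \<and> x \<in> H)"

definition normal_orthogroup :: "('a, 'm) semigrp_scheme \<Rightarrow> bool" where
  "normal_orthogroup S \<longleftrightarrow> completely_regular S \<and>
     subsemigroup (idempotents S) S \<and> normal_band (S\<lparr>carrier := idempotents S\<rparr>)"

definition pv_G :: "nat semigrp set" (\<open>\<G>\<close>) where
  "\<G> = {S. finite_semigroup S \<and> group_on S (carrier S)}"

definition pv_NB :: "nat semigrp set" (\<open>\<N>\<B>\<close>) where
  "\<N>\<B> = {S. finite_semigroup S \<and> normal_band S}"

definition pv_NOCR :: "nat semigrp set" (\<open>\<N>\<O>\<C>\<R>\<close>) where
  "\<N>\<O>\<C>\<R> = {S. finite_semigroup S \<and> normal_orthogroup S}"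


section \<open>Direct products and isomorphisms of lattices\<close>

definition prod_gorder :: "('a, 'm) gorder_scheme \<Rightarrow> ('b, 'n) gorder_scheme \<Rightarrow> ('a \<times> 'b) gorder"
    (infixr \<open>\<times>\<^sub>L\<close> 80) where
  "L \<times>\<^sub>L M = \<lparr> carrier = carrier L \<times> carrier M, eq = (=),
               le = (\<lambda>x y. fst x \<sqsubseteq>\<^bsub>L\<^esub> fst y \<and> snd x \<sqsubseteq>\<^bsub>M\<^esub> snd y) \<rparr>"

text \<open>Both \<open>join_pres\<close> and \<open>meet_pres\<close> include that \<open>L\<close> and \<open>M\<close> are lattices.\<close>

definition lattice_isomorphic :: "('a, 'm) gorder_scheme \<Rightarrow> ('b, 'n) gorder_scheme \<Rightarrow> bool"
    (infix \<open>\<cong>\<^sub>L\<close> 50) where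
  "L \<cong>\<^sub>L M \<longleftrightarrow>
     (\<exists>f. bij_betw f (carrier L) (carrier M) \<and> join_pres L M f \<and> meet_pres L M f)"

end

theory Submission
  imports Defs
begin

text \<open>Let \<open>S\<close> be a finite ordered normal orthogroup with set of idempotents \<open>E\<close> and maximal subgroups
  \<open>H\<^sub>e\<close>. Elements of \<open>H\<^sub>e\<close> commute with the idempotents below \<open>e\<close> in the natural
  order. Hence \<open>S \<rightarrow> E\<close>, mapping \<open>H\<^sub>a\<close> to \<open>a\<close>, is a homomorphism, and \<open>e x e y e = e x y e\<close> for
  \<open>x \<in> H\<^sub>a\<close> and \<open>y \<in> H\<^sub>b\<close> with \<open>e a e = e = e b e\<close>.
  It follows that
  \<open>S\<close> is an isotone homomorphic image of an ordered subsemigroup of \<open>E \<times> \<Prod>\<^sub>e H\<^sub>e\<close>, so a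
  pseudovariety contains \<open>S\<close> iff it contains \<open>E\<close> and all \<open>H\<^sub>e\<close>. A finite ordered group is
  trivially ordered. Therefore a pseudovariety of ordered normal orthogroups is determined by its bands
  and its groups, and conversely the orthogroups whose idempotents and subgroups lie in two prescribed
  pseudovarieties form a pseudovariety; for homomorphic images one uses that a
  subgroup of the image lifts to a subgroup.\<close>

section \<open>Finite semigroups\<close>

text \<open>Compression \<open>x \<mapsto> e x e\<close> is multiplicative only on elements whose
  idempotent \<open>a\<close> satisfies \<open>e a e = e\<close>, so in general it is no
  homomorphism from \<open>S\<close> to the maximal subgroup at \<open>e\<close>. Nor can
  \<open>S\<close> always be embedded into a product of a band and groups: a nontrivial group with
  an adjoined zero is collapsed on its group part by every homomorphism to a band or to a group.
  Hence \<open>S\<close> is only covered, by families that are constrained at the coordinates below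
  a stored idempotent and free elsewhere. The order is a second obstacle. The covering map must be
  isotone for the coordinatewise order, although two comparable families may be read at different
  coordinates \<open>a \<le> b\<close>. The idempotent \<open>a b a\<close> mediates: both families
  are constrained there, and stability gives \<open>a \<le> a b a \<le> b\<close>. A stable order on
  a finite group is trivial because \<open>e \<le> g\<close> makes the powers of \<open>g\<close>
  increase until they return to \<open>e\<close>.\<close>

locale sgrp =
  fixes S :: "('a, 'm) semigrp_scheme" (structure)
  assumes semigroup_str: "semigroup_str S"
begin

lemma closed [simp, intro]: "x \<in> carrier S \<Longrightarrow> y \<in> carrier S \<Longrightarrow> x \<bullet> y \<in> carrier S"
  using semigroup_str by (auto simp: semigroup_str_def)

lemma assoc:
  "x \<in> carrier S \<Longrightarrow> y \<in> carrier S \<Longrightarrow> z \<in> carrier S \<Longrightarrow> (x \<bullet> y) \<bullet> z = x \<bullet> (y \<bullet> z)"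
  using semigroup_str by (auto simp: semigroup_str_def)

lemma nonempty: "carrier S \<noteq> {}"
  using semigroup_str by (auto simp: semigroup_str_def)

end

lemma ord_semigroup_sgrp: "ord_semigroup_str S \<Longrightarrow> sgrp S"
  by (simp add: ord_semigroup_str_def sgrp_def)

text \<open>The exponent is shifted by one: \<open>spow S x n\<close> is the power of \<open>x\<close> with exponent \<open>n + 1\<close>.\<close>

primrec spow :: "('a, 'm) semigrp_scheme \<Rightarrow> 'a \<Rightarrow> nat \<Rightarrow> 'a" where
  "spow S x 0 = x"
| "spow S x (Suc n) = spow S x n \<bullet>\<^bsub>S\<^esub> x"

lemma spow_subsemigroup: "subsemigroup A S \<Longrightarrow> x \<in> A \<Longrightarrow> spow S x n \<in> A"
  by (induction n) (auto simp: subsemigroup_def)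

context sgrp
begin

lemma spow_closed [simp, intro]: "x \<in> carrier S \<Longrightarrow> spow S x n \<in> carrier S"
  by (induction n) auto

lemma spow_mult: "x \<in> carrier S \<Longrightarrow> spow S x m \<bullet> spow S x n = spow S x (Suc (m + n))"
  by (induction n) (auto simp flip: assoc)

lemma ex_idempotent_power:
  assumes fin: "finite (carrier S)" and x: "x \<in> carrier S"
  shows "\<exists>n. spow S x n \<in> idempotents S"
proof -
  have "range (spow S x) \<subseteq> carrier S" using x by auto
  then have "\<not> inj (spow S x)"
    using fin finite_subset finite_imageD infinite_UNIV_nat by blast
  then obtain i j where "spow S x i = spow S x j" "i < j"
    by (metis injI linorder_neqE_nat)
  then obtain p where eq: "spow S x i = spow S x (i + Suc p)"
    using less_iff_Suc_add by auto
  have step: "spow S x (i + k) = spow S x (i + k + Suc p)" for k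
  proof (cases k)
    case (Suc l)
    have "spow S x (i + Suc l) = spow S x i \<bullet> spow S x l" using x by (simp add: spow_mult)
    also have "\<dots> = spow S x (i + Suc p + Suc l)"
      unfolding eq using x by (simp only: spow_mult) simp
    finally show ?thesis using Suc by (simp add: add_ac)
  qed (use eq in simp)
  have iter: "spow S x (i + k) = spow S x (i + k + q * Suc p)" for k q
  proof (induction q)
    case (Suc q)
    then show ?case using step[of "k + q * Suc p"] by (simp add: add_ac)
  qed simp
  \<comment> \<open>The true exponent \<open>m + 1 = (i + 1) (p + 1)\<close> is a multiple of the
    period \<open>p + 1\<close>, and \<open>m\<close> is at least \<open>i\<close>, where
    periodicity starts. Squaring therefore adds whole periods only.\<close>
  define m where "m = i + i * p + p"
  have m: "Suc m = Suc i * Suc p" by (simp add: m_def)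
  have "spow S x m \<bullet> spow S x m = spow S x (m + Suc i * Suc p)"
    using x m by (simp add: spow_mult del: spow.simps)
  also have "\<dots> = spow S x m"
    using iter[of "i * p + p" "Suc i"] by (simp add: m_def add_ac)
  finally show ?thesis using x by (auto simp: idempotents_def)
qed

end

lemma subsemigroup_sgrp:
  assumes "semigroup_str S" "subsemigroup A S"
  shows "semigroup_str (S\<lparr>carrier := A\<rparr>)"
  using assms by (auto simp: semigroup_str_def subsemigroup_def subset_iff)

lemma subsemigroup_ord:
  assumes "ord_semigroup_str S" "subsemigroup A S"
  shows "ord_semigroup_str (S\<lparr>carrier := A\<rparr>)"
proof -
  have A: "A \<subseteq> carrier S" using assms by (simp add: subsemigroup_def)
  show ?thesis
    using assms subsemigroup_sgrp[of S A] A unfolding ord_semigroup_str_def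
    by (auto intro: reflp_on_subset antisymp_on_subset transp_on_subset)
qed

lemma finite_subsemigroup_ord:
  "finite_ord_semigroup S \<Longrightarrow> subsemigroup A S \<Longrightarrow> finite_ord_semigroup (S\<lparr>carrier := A\<rparr>)"
  by (auto simp: finite_ord_semigroup_def subsemigroup_ord) (auto simp: subsemigroup_def finite_subset)

lemma ex_idempotent_subsemigroup:
  assumes "semigroup_str S" "subsemigroup A S" "finite A"
  shows "A \<inter> idempotents S \<noteq> {}"
proof -
  interpret A: sgrp "S\<lparr>carrier := A\<rparr>"
    using assms subsemigroup_sgrp by (simp add: sgrp_def)
  obtain x where x: "x \<in> carrier (S\<lparr>carrier := A\<rparr>)" using A.nonempty by auto
  then obtain n where "spow (S\<lparr>carrier := A\<rparr>) x n \<in> idempotents (S\<lparr>carrier := A\<rparr>)"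
    using A.ex_idempotent_power assms by auto
  then show ?thesis using assms by (auto simp: idempotents_def subsemigroup_def)
qed

section \<open>Subgroups of a semigroup\<close>

text \<open>For an idempotent \<open>e\<close> this is the group of units of the local monoid
  \<open>e S e\<close>, that is, the maximal subgroup with identity \<open>e\<close>.\<close>

definition units_at :: "('a, 'm) semigrp_scheme \<Rightarrow> 'a \<Rightarrow> 'a set" where
  "units_at S e = {x \<in> carrier S. e \<bullet>\<^bsub>S\<^esub> x = x \<and> x \<bullet>\<^bsub>S\<^esub> e = x \<and>
     (\<exists>y \<in> carrier S. e \<bullet>\<^bsub>S\<^esub> y = y \<and> y \<bullet>\<^bsub>S\<^esub> e = y \<and> x \<bullet>\<^bsub>S\<^esub> y = e \<and> y \<bullet>\<^bsub>S\<^esub> x = e)}"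

lemma units_atE:
  assumes "x \<in> units_at S e"
  obtains y where "x \<in> carrier S" "e \<bullet>\<^bsub>S\<^esub> x = x" "x \<bullet>\<^bsub>S\<^esub> e = x" "y \<in> carrier S" "y \<in> units_at S e"
    "e \<bullet>\<^bsub>S\<^esub> y = y" "y \<bullet>\<^bsub>S\<^esub> e = y" "x \<bullet>\<^bsub>S\<^esub> y = e" "y \<bullet>\<^bsub>S\<^esub> x = e"
  using assms unfolding units_at_def by blast

text \<open>Unfolds the existentially quantified group record into conditions on the multiplication
  of \<open>S\<close>, the form in which subgroups are built and mapped below.\<close>

lemma group_on_iff:
  assumes "semigroup_str S" "H \<subseteq> carrier S"
  shows "group_on S H \<longleftrightarrow> (\<forall>x\<in>H. \<forall>y\<in>H. x \<bullet>\<^bsub>S\<^esub> y \<in> H) \<and>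
    (\<exists>e\<in>H. \<forall>x\<in>H. e \<bullet>\<^bsub>S\<^esub> x = x \<and> x \<bullet>\<^bsub>S\<^esub> e = x \<and> (\<exists>y\<in>H. x \<bullet>\<^bsub>S\<^esub> y = e \<and> y \<bullet>\<^bsub>S\<^esub> x = e))"
    (is "_ \<longleftrightarrow> ?R")
proof
  assume "group_on S H"
  then obtain e where e: "group \<lparr> carrier = H, monoid.mult = sg_mult S, one = e \<rparr>" (is "group ?G")
    by (auto simp: group_on_def)
  interpret group ?G by (rule e)
  have "\<exists>y\<in>H. x \<bullet>\<^bsub>S\<^esub> y = e \<and> y \<bullet>\<^bsub>S\<^esub> x = e" if "x \<in> H" for x
    using that inv_closed[of x] r_inv[of x] l_inv[of x] by auto
  then show ?R
    using m_closed one_closed l_one r_one by (intro conjI bexI[of _ e]) simp_all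
next
  assume R: ?R
  then obtain e where e: "e\<in>H" "\<forall>x\<in>H. e \<bullet>\<^bsub>S\<^esub> x = x \<and> x \<bullet>\<^bsub>S\<^esub> e = x \<and> (\<exists>y\<in>H. x \<bullet>\<^bsub>S\<^esub> y = e \<and> y \<bullet>\<^bsub>S\<^esub> x = e)"
    by blast
  have "group \<lparr> carrier = H, monoid.mult = sg_mult S, one = e \<rparr>"
    by (rule groupI) (use R e assms in \<open>auto simp: semigroup_str_def subset_iff\<close>)
  then show "group_on S H" using assms by (auto simp: group_on_def)
qed

lemma group_on_subsemigroup:
  assumes "semigroup_str S" "group_on S H"
  shows "subsemigroup H S"
  using assms group_on_iff[of S H] by (auto simp: group_on_def subsemigroup_def)

context sgrp
begin

lemma units_at_mult:
  assumes "x \<in> units_at S e" "y \<in> units_at S e" and e: "e \<in> idempotents S"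
  shows "x \<bullet> y \<in> units_at S e"
proof -
  obtain x' where x: "x \<in> carrier S" "e \<bullet> x = x" "x \<bullet> e = x" "x' \<in> carrier S"
    "e \<bullet> x' = x'" "x' \<bullet> e = x'" "x \<bullet> x' = e" "x' \<bullet> x = e" using assms(1) by (auto elim: units_atE)
  obtain y' where y: "y \<in> carrier S" "e \<bullet> y = y" "y \<bullet> e = y" "y' \<in> carrier S"
    "e \<bullet> y' = y'" "y' \<bullet> e = y'" "y \<bullet> y' = e" "y' \<bullet> y = e" using assms(2) by (auto elim: units_atE)
  have ec: "e \<in> carrier S" using e by (simp add: idempotents_def)
  have "(x \<bullet> y) \<bullet> (y' \<bullet> x') = x \<bullet> ((y \<bullet> y') \<bullet> x')" by (simp only: assoc closed x(1,4) y(1,4))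
  then have 1: "(x \<bullet> y) \<bullet> (y' \<bullet> x') = e" using x y by simp
  have "(y' \<bullet> x') \<bullet> (x \<bullet> y) = y' \<bullet> ((x' \<bullet> x) \<bullet> y)" by (simp only: assoc closed x(1,4) y(1,4))
  then have 2: "(y' \<bullet> x') \<bullet> (x \<bullet> y) = e" using x y by simp
  have 3: "e \<bullet> (x \<bullet> y) = x \<bullet> y" "e \<bullet> (y' \<bullet> x') = y' \<bullet> x'" using x y ec by (simp_all flip: assoc)
  have 4: "x \<bullet> y \<bullet> e = x \<bullet> y" "y' \<bullet> x' \<bullet> e = y' \<bullet> x'" using x y ec by (simp_all add: assoc)
  show ?thesis using x(1,4) y(1,4) 1 2 3 4 unfolding units_at_def by blast
qed

lemma idem_units_at: "e \<in> idempotents S \<Longrightarrow> e \<in> units_at S e"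
  by (auto simp: idempotents_def units_at_def)

lemma group_on_units_at:
  assumes e: "e \<in> idempotents S"
  shows "group_on S (units_at S e)"
proof (subst group_on_iff)
  show "units_at S e \<subseteq> carrier S" by (auto simp: units_at_def)
  have "e \<bullet> x = x \<and> x \<bullet> e = x \<and> (\<exists>y\<in>units_at S e. x \<bullet> y = e \<and> y \<bullet> x = e)" if "x \<in> units_at S e" for x
    using that by (rule units_atE) blast
  then show "(\<forall>x\<in>units_at S e. \<forall>y\<in>units_at S e. x \<bullet> y \<in> units_at S e) \<and>
    (\<exists>f\<in>units_at S e. \<forall>x\<in>units_at S e. f \<bullet> x = x \<and> x \<bullet> f = x \<and>
       (\<exists>y\<in>units_at S e. x \<bullet> y = f \<and> y \<bullet> x = f))"
    using units_at_mult[OF _ _ e] idem_units_at[OF e] by blast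
qed (rule semigroup_str)

lemma group_on_sub_units_at:
  assumes "group_on S H"
  obtains e where "e \<in> H" "e \<in> idempotents S" "H \<subseteq> units_at S e"
proof -
  have H: "H \<subseteq> carrier S" using assms by (simp add: group_on_def)
  obtain e where e: "e\<in>H" "\<And>x. x\<in>H \<Longrightarrow> e \<bullet> x = x \<and> x \<bullet> e = x \<and> (\<exists>y\<in>H. x \<bullet> y = e \<and> y \<bullet> x = e)"
    using assms group_on_iff[OF semigroup_str H] by blast
  have "e \<in> idempotents S" using e H by (auto simp: idempotents_def)
  moreover have "H \<subseteq> units_at S e" using e(2) H unfolding units_at_def by blast
  ultimately show ?thesis using e(1) that by blast
qed

text \<open>Both \<open>e\<close> and \<open>f\<close> fix \<open>x\<close> from either side.
  Writing \<open>e = x y\<close> gives \<open>f e = e\<close>, and writing \<open>f = z x\<close>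
  gives \<open>f e = f\<close>.\<close>

lemma units_at_unique:
  assumes "x \<in> units_at S e" "x \<in> units_at S f" "e \<in> carrier S" "f \<in> carrier S"
  shows "e = f"
proof -
  obtain y where x: "x \<in> carrier S" "y \<in> carrier S" "e \<bullet> x = x" "x \<bullet> e = x" "x \<bullet> y = e" 
    using assms(1) by (auto elim: units_atE)
  obtain z where z: "z \<in> carrier S" "f \<bullet> x = x" "x \<bullet> f = x" "z \<bullet> x = f" 
    using assms(2) by (auto elim: units_atE)
  have "f \<bullet> e = e" using x z assms by (metis assoc)
  moreover have "f \<bullet> e = f" using x z assms by (metis assoc)
  ultimately show ?thesis by simp
qed

end

text \<open>If \<open>y\<close> commutes with \<open>x\<close> and \<open>x y x = x\<close>, then
  \<open>e = x y\<close> is an idempotent fixing \<open>x\<close>. Since \<open>y\<close> itself may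
  lie outside \<open>e S e\<close>, the inverse in the maximal subgroup is \<open>y e\<close>.
  Unlike the existence of subgroups, this elementwise form is immediately checked in images and
  products.\<close>

lemma completely_regular_iff:
  fixes S :: "('a, 'm) semigrp_scheme" (structure)
  shows "completely_regular S \<longleftrightarrow> semigroup_str S \<and>
     (\<forall>x\<in>carrier S. \<exists>y\<in>carrier S. x \<bullet>\<^bsub>S\<^esub> y = y \<bullet>\<^bsub>S\<^esub> x \<and> x \<bullet>\<^bsub>S\<^esub> y \<bullet>\<^bsub>S\<^esub> x = x)" (is "?L \<longleftrightarrow> ?R")
proof
  assume L: ?L
  then interpret sgrp S by (simp add: completely_regular_def sgrp_def)
  have "\<exists>y\<in>carrier S. x \<bullet> y = y \<bullet> x \<and> x \<bullet> y \<bullet> x = x" if "x \<in> carrier S" for x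
  proof -
    have "\<exists>H. group_on S H \<and> x \<in> H" using L that by (simp add: completely_regular_def)
    then obtain H where "group_on S H" "x \<in> H" by blast
    then obtain e where "x \<in> units_at S e" by (meson group_on_sub_units_at subsetD)
    then show ?thesis by (metis units_atE)
  qed
  then show ?R using semigroup_str by blast
next
  assume R: ?R
  then interpret sgrp S by (simp add: sgrp_def)
  have "\<exists>H. group_on S H \<and> x \<in> H" if x: "x \<in> carrier S" for x
  proof -
    obtain y where y: "y \<in> carrier S" "x \<bullet> y = y \<bullet> x" "x \<bullet> y \<bullet> x = x" using R x by blast
    define e where "e = x \<bullet> y"
    have e: "e \<in> carrier S" "e \<bullet> x = x" using x y by (simp_all add: e_def)
    have xe: "x \<bullet> e = x" using x y by (simp add: e_def flip: assoc)
    have ee: "e \<bullet> e = e" using x y(1) e assoc[of e x y] by (simp add: e_def)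
    have ye: "e \<bullet> y = y \<bullet> e" using x y(1,2) assoc[of y x y] by (simp add: e_def)
    have "e \<bullet> (y \<bullet> e) = y \<bullet> e" using e(1) y(1) ye ee by (metis assoc)
    moreover have "(y \<bullet> e) \<bullet> e = y \<bullet> e" using e(1) y(1) ee by (simp add: assoc)
    moreover have "x \<bullet> (y \<bullet> e) = e" using e(1) x y(1) ee by (simp add: e_def flip: assoc)
    moreover have "(y \<bullet> e) \<bullet> x = e" using e x y(1) by (simp add: assoc) (simp add: e_def y(2))
    ultimately have "x \<in> units_at S e" using e x y xe closed[of y e] unfolding units_at_def by blast
    moreover have "e \<in> idempotents S" using e ee by (simp add: idempotents_def)
    ultimately show ?thesis using group_on_units_at by blast
  qed
  then show ?L using semigroup_str by (simp add: completely_regular_def)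
qed

section \<open>The structure of normal orthogroups\<close>

text \<open>The element usually written \<open>x^0\<close>: the identity of the maximal subgroup
  containing \<open>x\<close>, unique by \<open>units_at_unique\<close>. In the finite case it is
  the idempotent power of \<open>x\<close>, see \<open>idem_part_power\<close>.\<close>

definition idem_part :: "('a, 'm) semigrp_scheme \<Rightarrow> 'a \<Rightarrow> 'a" where
  "idem_part S x = (THE e. e \<in> idempotents S \<and> x \<in> units_at S e)"

locale nocr =
  fixes S :: "('a, 'm) semigrp_scheme" (structure)
  assumes normal_orthogroup: "normal_orthogroup S"

sublocale nocr \<subseteq> sgrp
  using normal_orthogroup
  by unfold_locales (simp add: normal_orthogroup_def completely_regular_def)

context nocr
begin

lemma idem_carrier [simp]: "e \<in> idempotents S \<Longrightarrow> e \<in> carrier S"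
  by (simp add: idempotents_def)

lemma idem_idem [simp]: "e \<in> idempotents S \<Longrightarrow> e \<bullet> e = e"
  unfolding idempotents_def by simp

lemma subsemigroup_idem: "subsemigroup (idempotents S) S"
  using normal_orthogroup by (simp add: normal_orthogroup_def)

lemma idem_mult [simp]: "e \<in> idempotents S \<Longrightarrow> f \<in> idempotents S \<Longrightarrow> e \<bullet> f \<in> idempotents S"
  using subsemigroup_idem by (simp add: subsemigroup_def)

lemma normal:
  "e \<in> idempotents S \<Longrightarrow> f \<in> idempotents S \<Longrightarrow> g \<in> idempotents S \<Longrightarrow>
    e \<bullet> f \<bullet> g \<bullet> e = e \<bullet> g \<bullet> f \<bullet> e"
  using normal_orthogroup by (simp add: normal_orthogroup_def normal_band_def)

lemma ex_units_at: "x \<in> carrier S \<Longrightarrow> \<exists>e \<in> idempotents S. x \<in> units_at S e"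
proof -
  assume x: "x \<in> carrier S"
  then have "\<exists>H. group_on S H \<and> x \<in> H"
    using normal_orthogroup by (simp add: normal_orthogroup_def completely_regular_def)
  then show ?thesis by (meson group_on_sub_units_at subsetD)
qed

lemma idem_part_eq:
  assumes "x \<in> units_at S e" "e \<in> idempotents S"
  shows "idem_part S x = e"
  unfolding idem_part_def using assms units_at_unique by (intro the_equality) auto

lemma idem_part:
  assumes "x \<in> carrier S"
  shows "idem_part S x \<in> idempotents S" "x \<in> units_at S (idem_part S x)"
  using ex_units_at[OF assms] idem_part_eq by auto

text \<open>In a band, \<open>f a f = f\<close> is the preorder "\<open>f\<close> lies in the ideal
  generated by \<open>a\<close>". Normality shortens the proof of transitivity:
  \<open>f = f e (a e) f = f (a e) e f = f a e f\<close>, so \<open>f\<close> starts with the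
  idempotent \<open>f a\<close>.\<close>

lemma below_trans:
  assumes E: "e \<in> idempotents S" "f \<in> idempotents S" "a \<in> idempotents S"
    and fe: "f \<bullet> e \<bullet> f = f" and ea: "e \<bullet> a \<bullet> e = e"
  shows "f \<bullet> a \<bullet> f = f"
proof -
  have "f = f \<bullet> e \<bullet> (a \<bullet> e) \<bullet> f" using E fe ea by (simp add: assoc)
  also have "\<dots> = f \<bullet> (a \<bullet> e) \<bullet> e \<bullet> f" using E by (intro normal) auto
  also have "\<dots> = f \<bullet> a \<bullet> (e \<bullet> f)" using E by (simp add: assoc)
  finally have *: "f = f \<bullet> a \<bullet> (e \<bullet> f)" .
  then have "f \<bullet> a \<bullet> f = f \<bullet> a \<bullet> (f \<bullet> a \<bullet> (e \<bullet> f))" by (rule arg_cong)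
  also have "\<dots> = f \<bullet> a \<bullet> (f \<bullet> a) \<bullet> (e \<bullet> f)" using E by (simp only: assoc closed idem_carrier)
  also have "\<dots> = f \<bullet> a \<bullet> (e \<bullet> f)" using E by (simp only: idem_idem idem_mult)
  finally show ?thesis by (simp only: *[symmetric])
qed

section \<open>Commutation with idempotents below in the natural order\<close>

lemma sandwich:
  assumes "a \<in> idempotents S" "e \<in> idempotents S"
  shows "a \<bullet> e \<bullet> a \<in> idempotents S" "a \<bullet> (a \<bullet> e \<bullet> a) = a \<bullet> e \<bullet> a" "a \<bullet> e \<bullet> a \<bullet> a = a \<bullet> e \<bullet> a"
proof -
  have c: "a \<in> carrier S" "e \<in> carrier S" "a \<bullet> a = a" using assms by auto
  show "a \<bullet> e \<bullet> a \<in> idempotents S" using assms by simp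
  show "a \<bullet> (a \<bullet> e \<bullet> a) = a \<bullet> e \<bullet> a" using c by (simp flip: assoc)
  show "a \<bullet> e \<bullet> a \<bullet> a = a \<bullet> e \<bullet> a" using c by (simp add: assoc)
qed

text \<open>Normal bands are locally semilattices: on \<open>a E a\<close> the outer factors of the
  law \<open>a c d a = a d c a\<close> are absorbed.\<close>

lemma below_commute:
  assumes "a \<in> idempotents S" "c \<in> idempotents S" "d \<in> idempotents S"
    and "a \<bullet> c = c" "c \<bullet> a = c" "a \<bullet> d = d" "d \<bullet> a = d"
  shows "c \<bullet> d = d \<bullet> c"
  using normal[of a c d] assms by (simp add: assoc)

text \<open>Complete regularity applied to \<open>c x\<close> yields \<open>c \<le> x c x\<^sup>-\<^sup>1\<close> in the natural order of
  idempotents; exchanging \<open>x\<close> and \<open>x\<^sup>-\<^sup>1\<close> gives equality.\<close>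

lemma conj_below:
  assumes a: "a \<in> idempotents S" and c: "c \<in> idempotents S" "a \<bullet> c = c" "c \<bullet> a = c"
    and x: "x \<in> carrier S" "a \<bullet> x = x" "x \<bullet> a = x"
    and y: "y \<in> carrier S" "a \<bullet> y = y" "y \<bullet> a = y" "x \<bullet> y = a" "y \<bullet> x = a"
  shows "x \<bullet> c \<bullet> y \<in> idempotents S" "x \<bullet> c \<bullet> y \<bullet> c = c" "c \<bullet> (x \<bullet> c \<bullet> y) = c"
proof -
  let ?g = "x \<bullet> c \<bullet> y"
  have cc: "a \<in> carrier S" "c \<in> carrier S" "?g \<in> carrier S" using a c x y by auto
  have "?g \<bullet> ?g = x \<bullet> c \<bullet> (y \<bullet> x) \<bullet> c \<bullet> y" using cc x y(1) by (simp only: assoc closed)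
  also have "\<dots> = ?g" using cc c x(1) y by (simp add: assoc)
  finally show g: "?g \<in> idempotents S" using cc unfolding idempotents_def by simp
  have ag: "a \<bullet> ?g = ?g" "?g \<bullet> a = ?g" using cc x y by (simp_all add: assoc) (simp_all flip: assoc)
  have comm: "c \<bullet> ?g = ?g \<bullet> c" by (rule below_commute[OF a c(1) g c(2,3) ag])
  let ?w = "c \<bullet> x"
  have w: "?w \<in> carrier S" using cc x by auto
  obtain e where "e \<in> idempotents S" "?w \<in> units_at S e" using ex_units_at[OF w] by blast
  then obtain w' where w': "w' \<in> carrier S" "?w \<bullet> w' = e" "?w \<bullet> e = ?w" by (auto elim: units_atE)
  \<comment> \<open>Here complete regularity enters: \<open>?w\<close> lies in
    \<open>?w ?w S\<close>. Since \<open>x c = ?g x\<close> and \<open>c\<close> commutes with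
    \<open>?g\<close>, the product \<open>?w ?w\<close> starts with \<open>?g\<close>. Hence
    \<open>c = ?w y\<close> lies in the right ideal of \<open>?g\<close>, on which the idempotent
    \<open>?g\<close> is a left identity.\<close>
  have "?w = ?w \<bullet> ?w \<bullet> w'" using assoc[OF w w w'(1)] unfolding w'(2,3) by (rule sym)
  then have wy: "?w \<bullet> y = ?w \<bullet> ?w \<bullet> w' \<bullet> y" by (rule arg_cong)
  have "?w \<bullet> y = c" using cc c(3) x(1) y(1,4) by (simp add: assoc)
  from this wy have 1: "c = ?w \<bullet> ?w \<bullet> w' \<bullet> y" by (rule trans[OF sym])
  have "?g \<bullet> x = x \<bullet> c" using cc c(3) x(1) y(1,5) by (simp add: assoc)
  then have "?w \<bullet> ?w = c \<bullet> (?g \<bullet> x) \<bullet> x" using cc x(1) by (simp add: assoc)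
  also have "\<dots> = ?g \<bullet> (c \<bullet> x \<bullet> x)" using cc x(1) comm by (simp flip: assoc)
  finally have 2: "?w \<bullet> ?w = ?g \<bullet> (c \<bullet> x \<bullet> x)" .
  define z where "z = c \<bullet> x \<bullet> x \<bullet> w' \<bullet> y"
  have z: "z \<in> carrier S" using cc x y(1) w' by (auto simp: z_def)
  have "?w \<bullet> ?w \<bullet> w' \<bullet> y = ?g \<bullet> z" unfolding 2 z_def using cc x(1) y(1) w'(1) by (simp only: assoc closed)
  with 1 have 3: "c = ?g \<bullet> z" by (rule trans)
  have "?g \<bullet> c = ?g \<bullet> (?g \<bullet> z)" using 3 by (rule arg_cong)
  also have "\<dots> = ?g \<bullet> z" using g cc z by (simp only: idem_idem flip: assoc)
  finally show gc: "?g \<bullet> c = c" by (simp only: 3[symmetric])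
  with comm show "c \<bullet> ?g = c" by (rule trans)
qed

lemma units_at_central:
  assumes a: "a \<in> idempotents S" and x: "x \<in> units_at S a"
    and c: "c \<in> idempotents S" "a \<bullet> c = c" "c \<bullet> a = c"
  shows "x \<bullet> c = c \<bullet> x"
proof -
  obtain y where y: "x \<in> carrier S" "a \<bullet> x = x" "x \<bullet> a = x" "y \<in> carrier S"
    "a \<bullet> y = y" "y \<bullet> a = y" "x \<bullet> y = a" "y \<bullet> x = a" using x by (auto elim: units_atE)
  have cc: "a \<in> carrier S" "c \<in> carrier S" using a c by auto
  let ?g = "x \<bullet> c \<bullet> y"
  have "c \<bullet> ?g = c"
    by (rule conj_below(3)[of a c x y]) (use a c y in auto)
  \<comment> \<open>The opposite inequality: with \<open>x\<close> and \<open>y\<close> exchanged,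
    the previous lemma gives \<open>y c x c = c\<close>, which is then multiplied by
    \<open>x\<close> on the left and \<open>y\<close> on the right.\<close>
  moreover have "c \<bullet> ?g = ?g"
  proof -
    have "x \<bullet> (y \<bullet> c \<bullet> x \<bullet> c) \<bullet> y = ?g"
      using conj_below(2)[of a c y x] a c y by simp
    moreover have "x \<bullet> (y \<bullet> c \<bullet> x \<bullet> c) \<bullet> y = (x \<bullet> y) \<bullet> c \<bullet> ?g"
      using y(1,4) cc by (simp only: assoc closed)
    ultimately show ?thesis using y(7) c by simp
  qed
  ultimately have "c = ?g" by (rule trans[OF sym])
  then have "c \<bullet> x = ?g \<bullet> x" by (rule arg_cong)
  also have "\<dots> = x \<bullet> c" using y(1,4) y(8) cc c(3) by (simp add: assoc)
  finally show ?thesis by (rule sym)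
qed

text \<open>The idempotents \<open>a b a\<close> and \<open>b a b\<close> commute with
  \<open>x\<close> and \<open>y\<close> respectively. An idempotent \<open>a b\<close> standing at
  either end of \<open>x y\<close> can thus be moved into the middle, where it is absorbed. This is
  what makes \<open>idem_part\<close> a homomorphism.\<close>

lemma units_at_prod:
  assumes a: "a \<in> idempotents S" "x \<in> units_at S a" and b: "b \<in> idempotents S" "y \<in> units_at S b"
  shows "x \<bullet> y \<in> units_at S (a \<bullet> b)"
proof -
  obtain x' where x: "x \<in> carrier S" "a \<bullet> x = x" "x \<bullet> a = x" "x' \<in> carrier S"
    "a \<bullet> x' = x'" "x' \<bullet> a = x'" "x \<bullet> x' = a" "x' \<bullet> x = a" using a(2) by (auto elim: units_atE)
  obtain y' where y: "y \<in> carrier S" "b \<bullet> y = y" "y \<bullet> b = y" "y' \<in> carrier S"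
    "b \<bullet> y' = y'" "y' \<bullet> b = y'" "y \<bullet> y' = b" "y' \<bullet> y = b" using b(2) by (auto elim: units_atE)
  have ab: "a \<in> carrier S" "b \<in> carrier S" using a b by auto
  have aa: "a \<bullet> a = a" "b \<bullet> b = b" using a b by auto
  have aba: "a \<bullet> b \<bullet> a \<in> idempotents S" "a \<bullet> (a \<bullet> b \<bullet> a) = a \<bullet> b \<bullet> a" "a \<bullet> b \<bullet> a \<bullet> a = a \<bullet> b \<bullet> a"
    using sandwich[OF a(1) b(1)] by auto
  have bab: "b \<bullet> a \<bullet> b \<in> idempotents S" "b \<bullet> (b \<bullet> a \<bullet> b) = b \<bullet> a \<bullet> b" "b \<bullet> a \<bullet> b \<bullet> b = b \<bullet> a \<bullet> b"
    using sandwich[OF b(1) a(1)] by auto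
  have cx: "x \<bullet> (a \<bullet> b \<bullet> a) = a \<bullet> b \<bullet> a \<bullet> x" by (rule units_at_central) (use a aba in auto)
  have cy: "y \<bullet> (b \<bullet> a \<bullet> b) = b \<bullet> a \<bullet> b \<bullet> y" by (rule units_at_central) (use b bab in auto)
  \<comment> \<open>Inserting \<open>b a\<close> in the middle changes nothing, because
    \<open>x = x a\<close>, \<open>y = b y\<close> and \<open>a b a b = a b\<close>. Idempotents
    moved to the middle are removed by this identity.\<close>
  have "x \<bullet> (b \<bullet> a) \<bullet> y = x \<bullet> a \<bullet> b \<bullet> a \<bullet> (b \<bullet> y)"
    using x y ab by (simp add: assoc)
  also have "\<dots> = x \<bullet> (a \<bullet> b \<bullet> (a \<bullet> b)) \<bullet> y" using x(1) y(1) ab by (simp only: assoc closed)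
  also have "\<dots> = (x \<bullet> a) \<bullet> (b \<bullet> y)" using x(1) y(1) ab a(1) b(1)
    by (simp only: idem_idem idem_mult) (simp only: assoc closed)
  finally have mid: "x \<bullet> (b \<bullet> a) \<bullet> y = x \<bullet> y" using x y by simp
  have "a \<bullet> b \<bullet> (x \<bullet> y) = a \<bullet> b \<bullet> ((a \<bullet> x) \<bullet> y)" using x by simp
  also have "\<dots> = a \<bullet> b \<bullet> a \<bullet> x \<bullet> y" using x(1) y(1) ab by (simp only: assoc closed)
  also have "\<dots> = x \<bullet> a \<bullet> (b \<bullet> a) \<bullet> y" unfolding cx[symmetric] using x(1) y(1) ab by (simp only: assoc closed)
  finally have l: "a \<bullet> b \<bullet> (x \<bullet> y) = x \<bullet> y" using mid x by simp
  have "x \<bullet> y \<bullet> (a \<bullet> b) = x \<bullet> (y \<bullet> b) \<bullet> (a \<bullet> b)" using y by simp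
  also have "\<dots> = x \<bullet> (y \<bullet> (b \<bullet> a \<bullet> b))" using x(1) y(1) ab by (simp only: assoc closed)
  also have "\<dots> = x \<bullet> (b \<bullet> a) \<bullet> (b \<bullet> y)" unfolding cy using x(1) y(1) ab by (simp only: assoc closed)
  finally have r: "x \<bullet> y \<bullet> (a \<bullet> b) = x \<bullet> y" using mid y by simp
  \<comment> \<open>The expected inverse \<open>y' x'\<close> belongs to the maximal subgroup at
    \<open>b a\<close>, so it is cut down to the local monoid of \<open>a b\<close>.\<close>
  let ?z = "a \<bullet> b \<bullet> (y' \<bullet> x') \<bullet> (a \<bullet> b)"
  have abi: "a \<bullet> b \<bullet> (a \<bullet> b) = a \<bullet> b" using a(1) b(1) by simp
  have "x \<bullet> y \<bullet> ?z = (x \<bullet> y \<bullet> (a \<bullet> b)) \<bullet> (y' \<bullet> x') \<bullet> (a \<bullet> b)"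
    using x(1,4) y(1,4) ab by (simp only: assoc closed)
  also have "\<dots> = x \<bullet> (y \<bullet> y') \<bullet> x' \<bullet> (a \<bullet> b)" unfolding r
    using x(1,4) y(1,4) ab by (simp only: assoc closed)
  also have "\<dots> = x \<bullet> a \<bullet> b \<bullet> (a \<bullet> x') \<bullet> (a \<bullet> b)" using x y by simp
  also have "\<dots> = x \<bullet> (a \<bullet> b \<bullet> a) \<bullet> x' \<bullet> (a \<bullet> b)" using x(1,4) ab by (simp only: assoc closed)
  also have "\<dots> = a \<bullet> b \<bullet> a \<bullet> (x \<bullet> x') \<bullet> (a \<bullet> b)" unfolding cx using x(1,4) ab by (simp only: assoc closed)
  also have "\<dots> = a \<bullet> b \<bullet> (a \<bullet> a \<bullet> a) \<bullet> b" unfolding x(7) using ab by (simp only: assoc closed)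
  also have "\<dots> = a \<bullet> b" using aa abi ab by (simp add: assoc)
  finally have 1: "x \<bullet> y \<bullet> ?z = a \<bullet> b" .
  have "?z \<bullet> (x \<bullet> y) = a \<bullet> b \<bullet> (y' \<bullet> x') \<bullet> (a \<bullet> b \<bullet> (x \<bullet> y))"
    using x(1,4) y(1,4) ab by (simp only: assoc closed)
  also have "\<dots> = a \<bullet> b \<bullet> y' \<bullet> (x' \<bullet> x) \<bullet> y" unfolding l
    using x(1,4) y(1,4) ab by (simp only: assoc closed)
  also have "\<dots> = a \<bullet> b \<bullet> (y' \<bullet> b) \<bullet> a \<bullet> (b \<bullet> y)" using x y by simp
  also have "\<dots> = a \<bullet> b \<bullet> y' \<bullet> (b \<bullet> a \<bullet> b \<bullet> y)" using y(1,4) ab by (simp only: assoc closed)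
  also have "\<dots> = a \<bullet> b \<bullet> (y' \<bullet> y) \<bullet> (b \<bullet> a \<bullet> b)" unfolding cy[symmetric] using y(1,4) ab by (simp only: assoc closed)
  also have "\<dots> = a \<bullet> (b \<bullet> b \<bullet> b) \<bullet> (a \<bullet> b)" unfolding y(8) using ab by (simp only: assoc closed)
  also have "\<dots> = a \<bullet> b" using aa abi ab by (simp add: assoc)
  finally have 2: "?z \<bullet> (x \<bullet> y) = a \<bullet> b" .
  have 3: "a \<bullet> b \<bullet> ?z = ?z"
  proof -
    have "a \<bullet> b \<bullet> ?z = (a \<bullet> b \<bullet> (a \<bullet> b)) \<bullet> (y' \<bullet> x') \<bullet> (a \<bullet> b)"
      using x(4) y(4) ab by (simp only: assoc closed)
    then show ?thesis unfolding abi .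
  qed
  have 4: "?z \<bullet> (a \<bullet> b) = ?z"
  proof -
    have "?z \<bullet> (a \<bullet> b) = a \<bullet> b \<bullet> (y' \<bullet> x') \<bullet> (a \<bullet> b \<bullet> (a \<bullet> b))"
      using x(4) y(4) ab by (simp only: assoc closed)
    then show ?thesis unfolding abi .
  qed
  have "x \<bullet> y \<in> carrier S" "?z \<in> carrier S" using x y ab by auto
  then show ?thesis using l r 1 2 3 4 unfolding units_at_def by blast
qed

lemma idem_part_mult:
  assumes "x \<in> carrier S" "y \<in> carrier S"
  shows "idem_part S (x \<bullet> y) = idem_part S x \<bullet> idem_part S y"
  using assms by (intro idem_part_eq units_at_prod) (auto simp: idem_part)

lemma idem_part_idem [simp]: "e \<in> idempotents S \<Longrightarrow> idem_part S e = e"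
  by (rule idem_part_eq) (auto intro: idem_units_at)

lemma idem_part_left [simp]: "x \<in> carrier S \<Longrightarrow> idem_part S x \<bullet> x = x"
  and idem_part_right [simp]: "x \<in> carrier S \<Longrightarrow> x \<bullet> idem_part S x = x"
  using idem_part(2)[of x] by (auto elim: units_atE)

text \<open>With \<open>e = e a e = e b e\<close>, the idempotents \<open>a e a\<close> and
  \<open>b e b\<close> can be inserted at the ends of \<open>x y\<close> and commuted into the
  middle. By normality their product is \<open>a e b\<close>, and \<open>x\<close>, \<open>y\<close>
  absorb \<open>a\<close>, \<open>b\<close>, so a single \<open>e\<close> remains between
  them.\<close>

lemma compress_mult:
  assumes e: "e \<in> idempotents S" and x: "x \<in> carrier S" and y: "y \<in> carrier S"
    and ex: "e \<bullet> idem_part S x \<bullet> e = e" and ey: "e \<bullet> idem_part S y \<bullet> e = e"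
  shows "e \<bullet> x \<bullet> e \<bullet> y \<bullet> e = e \<bullet> x \<bullet> y \<bullet> e"
proof -
  define a b where "a = idem_part S x" and "b = idem_part S y"
  have E: "a \<in> idempotents S" "b \<in> idempotents S" using x y by (auto simp: a_def b_def idem_part)
  have c: "a \<in> carrier S" "b \<in> carrier S" "e \<in> carrier S" using E e by auto
  have ax: "a \<bullet> x = x" "x \<bullet> a = x" "b \<bullet> y = y" "y \<bullet> b = y" using x y by (auto simp: a_def b_def)
  have ea: "e \<bullet> a \<bullet> e = e" "e \<bullet> b \<bullet> e = e" using ex ey by (auto simp: a_def b_def)
  have aea: "a \<bullet> e \<bullet> a \<in> idempotents S" "a \<bullet> (a \<bullet> e \<bullet> a) = a \<bullet> e \<bullet> a" "a \<bullet> e \<bullet> a \<bullet> a = a \<bullet> e \<bullet> a"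
    using sandwich[OF E(1) e] by auto
  have beb: "b \<bullet> e \<bullet> b \<in> idempotents S" "b \<bullet> (b \<bullet> e \<bullet> b) = b \<bullet> e \<bullet> b" "b \<bullet> e \<bullet> b \<bullet> b = b \<bullet> e \<bullet> b"
    using sandwich[OF E(2) e] by auto
  have cx: "x \<bullet> (a \<bullet> e \<bullet> a) = a \<bullet> e \<bullet> a \<bullet> x"
    by (rule units_at_central[OF E(1)]) (use aea idem_part(2)[OF x] in \<open>auto simp: a_def\<close>)
  have cy: "y \<bullet> (b \<bullet> e \<bullet> b) = b \<bullet> e \<bullet> b \<bullet> y"
    by (rule units_at_central[OF E(2)]) (use beb idem_part(2)[OF y] in \<open>auto simp: b_def\<close>)
  have band: "(a \<bullet> e \<bullet> a) \<bullet> (b \<bullet> e \<bullet> b) = a \<bullet> e \<bullet> b"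
  proof -
    have "e \<bullet> a \<bullet> b \<bullet> e = e \<bullet> (a \<bullet> e) \<bullet> b \<bullet> e"
    proof -
      have "e \<bullet> (a \<bullet> e) \<bullet> b \<bullet> e = e \<bullet> b \<bullet> (a \<bullet> e) \<bullet> e" using E e by (intro normal) auto
      also have "\<dots> = e \<bullet> b \<bullet> a \<bullet> e" using c e by (simp add: assoc)
      also have "\<dots> = e \<bullet> a \<bullet> b \<bullet> e" using E e by (intro normal) auto
      finally show ?thesis by simp
    qed
    also have "\<dots> = (e \<bullet> a \<bullet> e) \<bullet> b \<bullet> e" using c by (simp only: assoc closed)
    finally have *: "e \<bullet> a \<bullet> b \<bullet> e = e" using ea by simp
    have "(a \<bullet> e \<bullet> a) \<bullet> (b \<bullet> e \<bullet> b) = a \<bullet> (e \<bullet> a \<bullet> b \<bullet> e) \<bullet> b" using c by (simp only: assoc closed)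
    then show ?thesis unfolding * .
  qed
  have "e \<bullet> x \<bullet> y \<bullet> e = (e \<bullet> a \<bullet> e) \<bullet> (a \<bullet> x) \<bullet> (y \<bullet> b) \<bullet> (e \<bullet> b \<bullet> e)" using ax ea by simp
  also have "\<dots> = e \<bullet> (a \<bullet> e \<bullet> a \<bullet> x) \<bullet> (y \<bullet> (b \<bullet> e \<bullet> b)) \<bullet> e"
    using c x y by (simp only: assoc closed)
  also have "\<dots> = e \<bullet> x \<bullet> ((a \<bullet> e \<bullet> a) \<bullet> (b \<bullet> e \<bullet> b)) \<bullet> y \<bullet> e"
    unfolding cy cx[symmetric] using c x y by (simp only: assoc closed)
  also have "\<dots> = e \<bullet> (x \<bullet> a) \<bullet> e \<bullet> (b \<bullet> y) \<bullet> e"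
    unfolding band using c x y by (simp only: assoc closed)
  finally show ?thesis using ax by simp
qed

lemma compress_units_at:
  assumes "e \<in> idempotents S" "x \<in> carrier S" "e \<bullet> idem_part S x \<bullet> e = e"
  shows "e \<bullet> x \<bullet> e \<in> units_at S e"
proof -
  have "e \<bullet> x \<bullet> e \<in> units_at S (e \<bullet> idem_part S x \<bullet> e)"
    using assms by (intro units_at_prod) (auto simp: idem_part intro: idem_units_at)
  then show ?thesis using assms by simp
qed

end

section \<open>Elementwise characterization of normal orthogroups, subsemigroups and images\<close>

lemma normal_orthogroup_iff:
  fixes S :: "('a, 'm) semigrp_scheme" (structure)
  shows "normal_orthogroup S \<longleftrightarrow> semigroup_str S \<and>
    (\<forall>x\<in>carrier S. \<exists>y\<in>carrier S. x \<bullet> y = y \<bullet> x \<and> x \<bullet> y \<bullet> x = x) \<and>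
    (\<forall>e\<in>idempotents S. \<forall>f\<in>idempotents S. e \<bullet> f \<in> idempotents S) \<and>
    (\<forall>e\<in>idempotents S. \<forall>f\<in>idempotents S. \<forall>g\<in>idempotents S. e \<bullet> f \<bullet> g \<bullet> e = e \<bullet> g \<bullet> f \<bullet> e)"
    (is "?L \<longleftrightarrow> ?R")
proof
  assume L: ?L
  then interpret nocr S by (simp add: nocr_def)
  have "\<forall>x\<in>carrier S. \<exists>y\<in>carrier S. x \<bullet> y = y \<bullet> x \<and> x \<bullet> y \<bullet> x = x"
    using L completely_regular_iff[of S] by (simp add: normal_orthogroup_def)
  then show ?R using semigroup_str idem_mult normal by blast
next
  assume R: ?R
  have cr: "completely_regular S" using R completely_regular_iff[of S] by blast
  interpret sgrp S using R by (simp add: sgrp_def)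
  have "idempotents S \<noteq> {}"
  proof -
    obtain x where "x \<in> carrier S" using nonempty by blast
    then obtain H where "group_on S H" using cr by (auto simp: completely_regular_def)
    then show ?thesis by (auto elim: group_on_sub_units_at)
  qed
  then have sub: "subsemigroup (idempotents S) S"
    using R by (auto simp: subsemigroup_def idempotents_def)
  moreover have "normal_band (S\<lparr>carrier := idempotents S\<rparr>)"
    using R subsemigroup_sgrp[OF semigroup_str sub] by (auto simp: normal_band_def idempotents_def)
  ultimately show ?L using cr by (simp add: normal_orthogroup_def)
qed

lemma (in nocr) ex_inverse:
  "x \<in> carrier S \<Longrightarrow> \<exists>y\<in>carrier S. x \<bullet> y = y \<bullet> x \<and> x \<bullet> y \<bullet> x = x"
  using normal_orthogroup[unfolded normal_orthogroup_iff] by blast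

lemma (in nocr) below_left:
  assumes "a \<in> idempotents S" "b \<in> idempotents S"
  shows "a \<bullet> b \<bullet> a \<bullet> (a \<bullet> b) = a \<bullet> b"
proof -
  have "a \<bullet> b \<bullet> a \<bullet> (a \<bullet> b) = a \<bullet> b \<bullet> (a \<bullet> a) \<bullet> b" using assms by (simp only: assoc closed idem_carrier)
  also have "\<dots> = a \<bullet> b \<bullet> (a \<bullet> b)"
    using assms by (simp only: idem_idem assoc closed idem_carrier)
  finally show ?thesis using assms by simp
qed

lemma (in nocr) below_right:
  assumes "a \<in> idempotents S" "b \<in> idempotents S"
  shows "a \<bullet> b \<bullet> b \<bullet> (a \<bullet> b) = a \<bullet> b"
proof -
  have "a \<bullet> b \<bullet> b \<bullet> (a \<bullet> b) = a \<bullet> (b \<bullet> b) \<bullet> (a \<bullet> b)" using assms by (simp only: assoc closed idem_carrier)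
  then show ?thesis using assms by simp
qed

text \<open>The powers of \<open>x\<close> form a finite subsemigroup, so one of them is idempotent.
  All of them lie in the maximal subgroup of \<open>x\<close>, whose only idempotent is its
  identity.\<close>

lemma (in nocr) idem_part_power:
  assumes A: "subsemigroup A S" "finite A" "x \<in> A"
  shows "\<exists>n. spow S x n = idem_part S x"
proof -
  have x: "x \<in> carrier S" using A by (auto simp: subsemigroup_def)
  have e: "idem_part S x \<in> idempotents S" "x \<in> units_at S (idem_part S x)" using idem_part[OF x] by auto
  have "subsemigroup (range (spow S x)) S"
    unfolding subsemigroup_def using x by (auto simp: spow_mult simp del: spow.simps)
  moreover have "finite (range (spow S x))"
    using A spow_subsemigroup[OF A(1,3)] by (meson finite_subset image_subsetI)
  ultimately obtain n where n: "spow S x n \<in> idempotents S"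
    using ex_idempotent_subsemigroup[OF semigroup_str] by blast
  have "spow S x n \<in> units_at S (idem_part S x)"
    by (rule spow_subsemigroup[OF group_on_subsemigroup[OF semigroup_str group_on_units_at[OF e(1)]] e(2)])
  then have "idem_part S x = spow S x n"
    using n e(1) by (metis idem_part_eq idem_units_at)
  then show ?thesis by metis
qed

lemma idempotents_sub: "A \<subseteq> carrier S \<Longrightarrow> idempotents (S\<lparr>carrier := A\<rparr>) = A \<inter> idempotents S"
  by (auto simp: idempotents_def)

text \<open>Inverses in maximal subgroups are obtained as powers, so a finite subsemigroup contains
  them; the conditions on idempotents restrict directly.\<close>

lemma normal_orthogroup_sub:
  assumes S: "normal_orthogroup S" and A: "subsemigroup A S" "finite A"
  shows "normal_orthogroup (S\<lparr>carrier := A\<rparr>)"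
proof -
  interpret nocr S using S by (simp add: nocr_def)
  have AS: "A \<subseteq> carrier S" using A by (simp add: subsemigroup_def)
  have "\<exists>y\<in>A. x \<bullet>\<^bsub>S\<^esub> y = y \<bullet>\<^bsub>S\<^esub> x \<and> x \<bullet>\<^bsub>S\<^esub> y \<bullet>\<^bsub>S\<^esub> x = x" if x: "x \<in> A" for x
  proof -
    have xS: "x \<in> carrier S" using x AS by auto
    obtain n where n: "spow S x n = idem_part S x" using idem_part_power[OF A x] by blast
    show ?thesis
    proof (cases n)
      \<comment> \<open>With shifted exponents, \<open>n = 0\<close> means that \<open>x\<close>
        itself is idempotent and serves as its own inverse. Otherwise the inverse is the power just
        before the idempotent one.\<close>
      case 0
      then have "x \<bullet>\<^bsub>S\<^esub> x = x" using n xS idem_part_left[OF xS] by simp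
      then show ?thesis using x by auto
    next
      case (Suc m)
      have "spow S x 0 \<bullet>\<^bsub>S\<^esub> spow S x m = idem_part S x" "spow S x m \<bullet>\<^bsub>S\<^esub> spow S x 0 = idem_part S x"
        using n Suc xS by (simp_all only: spow_mult) simp_all
      then have "x \<bullet>\<^bsub>S\<^esub> spow S x m = idem_part S x" "spow S x m \<bullet>\<^bsub>S\<^esub> x = idem_part S x" by simp_all
      then show ?thesis using spow_subsemigroup[OF A(1) x] idem_part_left[OF xS] by metis
    qed
  qed
  then show ?thesis
    unfolding normal_orthogroup_iff idempotents_sub[OF AS]
    using subsemigroup_sgrp[OF semigroup_str A(1)] idem_mult normal A by (auto simp: subsemigroup_def)
qed

lemma sg_hom_closed: "h \<in> sg_hom S T \<Longrightarrow> x \<in> carrier S \<Longrightarrow> h x \<in> carrier T"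
  and sg_hom_mult: "h \<in> sg_hom S T \<Longrightarrow> x \<in> carrier S \<Longrightarrow> y \<in> carrier S \<Longrightarrow>
    h (x \<bullet>\<^bsub>S\<^esub> y) = h x \<bullet>\<^bsub>T\<^esub> h y"
  by (auto simp: sg_hom_def)

lemma sg_hom_idem: "h \<in> sg_hom S T \<Longrightarrow> e \<in> idempotents S \<Longrightarrow> h e \<in> idempotents T"
  unfolding idempotents_def sg_hom_def by force

text \<open>Take any preimage \<open>s\<close> of \<open>f\<close> and let \<open>e\<close> be the
  identity of its maximal subgroup. The image of that subgroup is a group with identity
  \<open>h e\<close>, and its idempotent \<open>f = h s\<close> must be this identity.\<close>

lemma (in nocr) lift_idempotent:
  assumes h: "h \<in> sg_hom S T" "h ` carrier S = carrier T" and T: "semigroup_str T"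
    and f: "f \<in> idempotents T"
  shows "\<exists>e \<in> idempotents S. h e = f"
proof -
  interpret T: sgrp T using T by (simp add: sgrp_def)
  have fT: "f \<in> carrier T" "f \<bullet>\<^bsub>T\<^esub> f = f" using f by (auto simp: idempotents_def)
  obtain s where s: "s \<in> carrier S" "h s = f" using fT h(2) by (metis imageE)
  define e where "e = idem_part S s"
  have e: "e \<in> idempotents S" "s \<in> units_at S e" using idem_part[OF s(1)] by (auto simp: e_def)
  obtain y where y: "y \<in> carrier S" "s \<bullet> y = e" "s \<bullet> e = s" using e(2) by (auto elim: units_atE)
  have hy: "h y \<in> carrier T" using h y sg_hom_closed by metis
  have fe: "f \<bullet>\<^bsub>T\<^esub> h y = h e" using sg_hom_mult[OF h(1) s(1) y(1)] y s by simp
  have "f \<bullet>\<^bsub>T\<^esub> h e = f" using sg_hom_mult[OF h(1) s(1) idem_carrier[OF e(1)]] y s by simp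
  moreover have "f \<bullet>\<^bsub>T\<^esub> h e = h e" using T.assoc[OF fT(1) fT(1) hy] fT(2) by (simp add: fe)
  ultimately show ?thesis using e by auto
qed

lemma normal_orthogroup_hom:
  assumes S: "normal_orthogroup S" and T: "semigroup_str T"
    and h: "h \<in> sg_hom S T" "h ` carrier S = carrier T"
  shows "normal_orthogroup T"
proof -
  interpret nocr S using S by (simp add: nocr_def)
  note lift = lift_idempotent[OF h T]
  note hom = sg_hom_mult[OF h(1)]
  have "\<exists>y\<in>carrier T. x \<bullet>\<^bsub>T\<^esub> y = y \<bullet>\<^bsub>T\<^esub> x \<and> x \<bullet>\<^bsub>T\<^esub> y \<bullet>\<^bsub>T\<^esub> x = x" if "x \<in> carrier T" for x
  proof -
    have "x \<in> h ` carrier S" using h(2) that by simp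
    then obtain s where s: "s \<in> carrier S" "x = h s" by blast
    then obtain y where y: "y \<in> carrier S" "s \<bullet>\<^bsub>S\<^esub> y = y \<bullet>\<^bsub>S\<^esub> s" "s \<bullet>\<^bsub>S\<^esub> y \<bullet>\<^bsub>S\<^esub> s = s"
      using ex_inverse by blast
    have 1: "h s \<bullet>\<^bsub>T\<^esub> h y = h (s \<bullet>\<^bsub>S\<^esub> y)" "h y \<bullet>\<^bsub>T\<^esub> h s = h (y \<bullet>\<^bsub>S\<^esub> s)"
      using hom s y(1) by simp_all
    have "h s \<bullet>\<^bsub>T\<^esub> h y \<bullet>\<^bsub>T\<^esub> h s = h (s \<bullet>\<^bsub>S\<^esub> y \<bullet>\<^bsub>S\<^esub> s)" using 1 hom s(1) y(1) by simp
    then show ?thesis using 1 y s(2) by (intro bexI[OF _ sg_hom_closed[OF h(1) y(1)]]) simp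
  qed
  moreover have "e \<bullet>\<^bsub>T\<^esub> f \<in> idempotents T" if ef: "e \<in> idempotents T" "f \<in> idempotents T" for e f
  proof -
    obtain e' f' where *: "e' \<in> idempotents S" "f' \<in> idempotents S" "e = h e'" "f = h f'"
      using lift ef by metis
    then have "h (e' \<bullet>\<^bsub>S\<^esub> f') \<in> idempotents T" by (intro sg_hom_idem[OF h(1)]) simp
    then show ?thesis using * hom by simp
  qed
  moreover have "e \<bullet>\<^bsub>T\<^esub> f \<bullet>\<^bsub>T\<^esub> g \<bullet>\<^bsub>T\<^esub> e = e \<bullet>\<^bsub>T\<^esub> g \<bullet>\<^bsub>T\<^esub> f \<bullet>\<^bsub>T\<^esub> e"
    if ef: "e \<in> idempotents T" "f \<in> idempotents T" "g \<in> idempotents T" for e f g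
  proof -
    obtain e' f' g' where *: "e' \<in> idempotents S" "f' \<in> idempotents S" "g' \<in> idempotents S"
      "e = h e'" "f = h f'" "g = h g'"
      using lift ef by metis
    have "h (e' \<bullet>\<^bsub>S\<^esub> f' \<bullet>\<^bsub>S\<^esub> g' \<bullet>\<^bsub>S\<^esub> e') = h (e' \<bullet>\<^bsub>S\<^esub> g' \<bullet>\<^bsub>S\<^esub> f' \<bullet>\<^bsub>S\<^esub> e')"
      using normal[OF *(1-3)] by (rule arg_cong)
    then show ?thesis using * hom by simp
  qed
  ultimately show ?thesis using T unfolding normal_orthogroup_iff by blast
qed

section \<open>Direct products and divisors\<close>

lemma osg_prod_simps [simp]:
  "carrier (osg_prod I S) = (\<Pi>\<^sub>E i \<in> I. carrier (S i))"
  "x \<bullet>\<^bsub>osg_prod I S\<^esub> y = (\<lambda>i \<in> I. x i \<bullet>\<^bsub>S i\<^esub> y i)"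
  "x \<preceq>\<^bsub>osg_prod I S\<^esub> y \<longleftrightarrow> (\<forall>i \<in> I. x i \<preceq>\<^bsub>S i\<^esub> y i)"
  by (simp_all add: osg_prod_def)

lemma osg_prod_semigroup:
  assumes "\<And>i. i \<in> I \<Longrightarrow> semigroup_str (S i)"
  shows "semigroup_str (osg_prod I S)"
proof -
  have "sgrp (S i)" if "i \<in> I" for i using assms that by (simp add: sgrp_def)
  note * = sgrp.nonempty[OF this] sgrp.closed[OF this] sgrp.assoc[OF this]
  show ?thesis
    unfolding semigroup_str_def
  proof (intro conjI ballI)
    show "carrier (osg_prod I S) \<noteq> {}" using * by (simp add: PiE_eq_empty_iff)
  next
    fix x y assume "x \<in> carrier (osg_prod I S)" "y \<in> carrier (osg_prod I S)"
    then show "x \<bullet>\<^bsub>osg_prod I S\<^esub> y \<in> carrier (osg_prod I S)" using * by (auto simp: PiE_iff)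
  next
    fix x y z assume "x \<in> carrier (osg_prod I S)" "y \<in> carrier (osg_prod I S)" "z \<in> carrier (osg_prod I S)"
    then show "x \<bullet>\<^bsub>osg_prod I S\<^esub> y \<bullet>\<^bsub>osg_prod I S\<^esub> z = x \<bullet>\<^bsub>osg_prod I S\<^esub> (y \<bullet>\<^bsub>osg_prod I S\<^esub> z)"
      using * by (auto simp: PiE_iff intro!: restrict_ext)
  qed
qed

lemma ord_le_trans:
  "ord_semigroup_str S \<Longrightarrow> x \<in> carrier S \<Longrightarrow> y \<in> carrier S \<Longrightarrow> z \<in> carrier S \<Longrightarrow>
    x \<preceq>\<^bsub>S\<^esub> y \<Longrightarrow> y \<preceq>\<^bsub>S\<^esub> z \<Longrightarrow> x \<preceq>\<^bsub>S\<^esub> z"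
  unfolding ord_semigroup_str_def transp_on_def by blast

lemma ord_le_antisym:
  "ord_semigroup_str S \<Longrightarrow> x \<in> carrier S \<Longrightarrow> y \<in> carrier S \<Longrightarrow>
    x \<preceq>\<^bsub>S\<^esub> y \<Longrightarrow> y \<preceq>\<^bsub>S\<^esub> x \<Longrightarrow> x = y"
  unfolding ord_semigroup_str_def antisymp_on_def by blast

lemma ord_le_refl: "ord_semigroup_str S \<Longrightarrow> x \<in> carrier S \<Longrightarrow> x \<preceq>\<^bsub>S\<^esub> x"
  unfolding ord_semigroup_str_def reflp_on_def by blast

lemma ord_le_stable:
  "ord_semigroup_str S \<Longrightarrow> x \<in> carrier S \<Longrightarrow> y \<in> carrier S \<Longrightarrow> z \<in> carrier S \<Longrightarrow>
    x \<preceq>\<^bsub>S\<^esub> y \<Longrightarrow> z \<bullet>\<^bsub>S\<^esub> x \<preceq>\<^bsub>S\<^esub> z \<bullet>\<^bsub>S\<^esub> y \<and> x \<bullet>\<^bsub>S\<^esub> z \<preceq>\<^bsub>S\<^esub> y \<bullet>\<^bsub>S\<^esub> z"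
  unfolding ord_semigroup_str_def by blast

lemma ord_le_mult:
  assumes S: "ord_semigroup_str S" and c: "x \<in> carrier S" "y \<in> carrier S" "u \<in> carrier S" "v \<in> carrier S"
    and le: "x \<preceq>\<^bsub>S\<^esub> y" "u \<preceq>\<^bsub>S\<^esub> v"
  shows "x \<bullet>\<^bsub>S\<^esub> u \<preceq>\<^bsub>S\<^esub> y \<bullet>\<^bsub>S\<^esub> v"
proof -
  interpret sgrp S using S by (rule ord_semigroup_sgrp)
  have "x \<bullet>\<^bsub>S\<^esub> u \<preceq>\<^bsub>S\<^esub> y \<bullet>\<^bsub>S\<^esub> u" "y \<bullet>\<^bsub>S\<^esub> u \<preceq>\<^bsub>S\<^esub> y \<bullet>\<^bsub>S\<^esub> v"
    using ord_le_stable[OF S c(1,2,3) le(1)] ord_le_stable[OF S c(3,4,2) le(2)] by simp_all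
  then show ?thesis using c by (intro ord_le_trans[OF S _ _ _ \<open>x \<bullet>\<^bsub>S\<^esub> u \<preceq>\<^bsub>S\<^esub> y \<bullet>\<^bsub>S\<^esub> u\<close>]) simp_all
qed

lemma osg_prod_ord:
  assumes S: "\<And>i. i \<in> I \<Longrightarrow> ord_semigroup_str (S i)"
  shows "ord_semigroup_str (osg_prod I S)"
proof -
  have sg: "semigroup_str (osg_prod I S)"
    using S by (intro osg_prod_semigroup) (auto simp: ord_semigroup_str_def)
  show ?thesis
    unfolding ord_semigroup_str_def
  proof (intro conjI ballI impI)
    show "reflp_on (carrier (osg_prod I S)) (sg_le (osg_prod I S))"
      using ord_le_refl[OF S] by (auto simp: reflp_on_def PiE_iff)
    show "antisymp_on (carrier (osg_prod I S)) (sg_le (osg_prod I S))"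
      unfolding antisymp_on_def
    proof (intro ballI impI)
      fix x y
      assume xy: "x \<in> carrier (osg_prod I S)" "y \<in> carrier (osg_prod I S)"
        and le: "x \<preceq>\<^bsub>osg_prod I S\<^esub> y" "y \<preceq>\<^bsub>osg_prod I S\<^esub> x"
      have "x i = y i" if "i \<in> I" for i
        using that xy le by (intro ord_le_antisym[OF S]) (auto simp: PiE_iff)
      then show "x = y" using xy by (auto intro: PiE_ext)
    qed
    show "transp_on (carrier (osg_prod I S)) (sg_le (osg_prod I S))"
      using ord_le_trans[OF S] unfolding transp_on_def by (simp add: PiE_iff) blast
  qed (use sg ord_le_stable[OF S] in \<open>auto simp: PiE_iff\<close>)
qed

lemma osg_prod_finite_ord:
  assumes "finite I" "\<And>i. i \<in> I \<Longrightarrow> finite_ord_semigroup (S i)"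
  shows "finite_ord_semigroup (osg_prod I S)"
  using assms unfolding finite_ord_semigroup_def by (auto intro!: osg_prod_ord finite_PiE)

lemma idempotents_osg_prod:
  "idempotents (osg_prod I S) = (\<Pi>\<^sub>E i \<in> I. idempotents (S i))"
proof -
  have "x \<bullet>\<^bsub>osg_prod I S\<^esub> x = x \<longleftrightarrow> (\<forall>i\<in>I. x i \<bullet>\<^bsub>S i\<^esub> x i = x i)"
    if "x \<in> carrier (osg_prod I S)" for x
    using that by (auto simp: PiE_iff extensional_def restrict_def fun_eq_iff)
  then have *: "x \<in> idempotents (osg_prod I S) \<longleftrightarrow>
      x \<in> carrier (osg_prod I S) \<and> (\<forall>i\<in>I. x i \<bullet>\<^bsub>S i\<^esub> x i = x i)" for x
    unfolding idempotents_def by blast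
  show ?thesis
  proof (rule Set.set_eqI)
    fix x
    show "x \<in> idempotents (osg_prod I S) \<longleftrightarrow> x \<in> (\<Pi>\<^sub>E i \<in> I. idempotents (S i))"
      unfolding *[of x] by (auto simp: PiE_iff idempotents_def)
  qed
qed

lemma normal_orthogroup_osg_prod:
  assumes S: "\<And>i. i \<in> I \<Longrightarrow> normal_orthogroup (S i)"
  shows "normal_orthogroup (osg_prod I S)"
proof -
  have N: "nocr (S i)" if "i \<in> I" for i using S that by (simp add: nocr_def)
  have sg: "semigroup_str (osg_prod I S)"
    using S by (intro osg_prod_semigroup) (simp add: normal_orthogroup_iff)
  have "\<exists>y\<in>carrier (osg_prod I S). x \<bullet>\<^bsub>osg_prod I S\<^esub> y = y \<bullet>\<^bsub>osg_prod I S\<^esub> x \<and>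
      x \<bullet>\<^bsub>osg_prod I S\<^esub> y \<bullet>\<^bsub>osg_prod I S\<^esub> x = x" if x: "x \<in> carrier (osg_prod I S)" for x
  proof -
    have "\<forall>i\<in>I. \<exists>y\<in>carrier (S i). x i \<bullet>\<^bsub>S i\<^esub> y = y \<bullet>\<^bsub>S i\<^esub> x i \<and> x i \<bullet>\<^bsub>S i\<^esub> y \<bullet>\<^bsub>S i\<^esub> x i = x i"
      using nocr.ex_inverse[OF N] x by (auto simp: PiE_iff)
    then obtain y where y: "\<forall>i\<in>I. y i\<in>carrier (S i) \<and> x i \<bullet>\<^bsub>S i\<^esub> y i = y i \<bullet>\<^bsub>S i\<^esub> x i \<and>
        x i \<bullet>\<^bsub>S i\<^esub> y i \<bullet>\<^bsub>S i\<^esub> x i = x i"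
      by (metis bchoice)
    have "restrict y I \<in> carrier (osg_prod I S)" using y by auto
    moreover have "x \<bullet>\<^bsub>osg_prod I S\<^esub> restrict y I = restrict y I \<bullet>\<^bsub>osg_prod I S\<^esub> x"
      using y by (auto intro: restrict_ext)
    moreover have "x \<bullet>\<^bsub>osg_prod I S\<^esub> restrict y I \<bullet>\<^bsub>osg_prod I S\<^esub> x = x"
      using y x by (auto simp: PiE_iff extensional_def restrict_def fun_eq_iff)
    ultimately show ?thesis by blast
  qed
  moreover have "x \<bullet>\<^bsub>osg_prod I S\<^esub> y \<in> idempotents (osg_prod I S)"
    if "x \<in> idempotents (osg_prod I S)" "y \<in> idempotents (osg_prod I S)" for x y
    using that nocr.idem_mult[OF N] unfolding idempotents_osg_prod by (auto simp: PiE_iff)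
  moreover have "x \<bullet>\<^bsub>osg_prod I S\<^esub> y \<bullet>\<^bsub>osg_prod I S\<^esub> z \<bullet>\<^bsub>osg_prod I S\<^esub> x
      = x \<bullet>\<^bsub>osg_prod I S\<^esub> z \<bullet>\<^bsub>osg_prod I S\<^esub> y \<bullet>\<^bsub>osg_prod I S\<^esub> x"
    if "x \<in> idempotents (osg_prod I S)" "y \<in> idempotents (osg_prod I S)" "z \<in> idempotents (osg_prod I S)" for x y z
    using that nocr.normal[OF N] unfolding idempotents_osg_prod by (auto simp: PiE_iff intro!: restrict_ext)
  ultimately show ?thesis using sg unfolding normal_orthogroup_iff by blast
qed

text \<open>Products live on functions, whereas membership in a pseudovariety only makes sense for
  carriers of natural numbers.\<close>

lemma ex_nat_copy:
  fixes P :: "('a, 'm) ord_semigrp_scheme"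
  assumes P: "finite_ord_semigroup P"
  shows "\<exists>(T :: nat ord_semigrp) \<phi>. finite_ord_semigroup T \<and> \<phi> \<in> osg_iso P T"
proof -
  have ord: "ord_semigroup_str P" and fin: "finite (carrier P)"
    using P by (auto simp: finite_ord_semigroup_def)
  interpret sgrp P using ord by (rule ord_semigroup_sgrp)
  obtain \<phi> where \<phi>: "bij_betw \<phi> (carrier P) {0..<card (carrier P)}"
    using ex_bij_betw_finite_nat[OF fin] by blast
  define \<psi> where "\<psi> = inv_into (carrier P) \<phi>"
  define T :: "nat ord_semigrp" where "T = \<lparr> carrier = \<phi> ` carrier P,
    sg_mult = (\<lambda>a b. \<phi> (\<psi> a \<bullet>\<^bsub>P\<^esub> \<psi> b)), sg_le = (\<lambda>a b. \<psi> a \<preceq>\<^bsub>P\<^esub> \<psi> b) \<rparr>"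
  have inj: "inj_on \<phi> (carrier P)" using \<phi> by (rule bij_betw_imp_inj_on)
  have \<psi>: "\<psi> (\<phi> x) = x" if "x \<in> carrier P" for x
    using that inj by (simp add: \<psi>_def)
  have m: "\<phi> x \<bullet>\<^bsub>T\<^esub> \<phi> y = \<phi> (x \<bullet>\<^bsub>P\<^esub> y)" if "x \<in> carrier P" "y \<in> carrier P" for x y
    using that \<psi> by (simp add: T_def)
  have l: "\<phi> x \<preceq>\<^bsub>T\<^esub> \<phi> y \<longleftrightarrow> x \<preceq>\<^bsub>P\<^esub> y" if "x \<in> carrier P" "y \<in> carrier P" for x y
    using that \<psi> by (simp add: T_def)
  have c: "carrier T = \<phi> ` carrier P" by (simp add: T_def)
  have "semigroup_str T"
    unfolding semigroup_str_def c using nonempty by (auto simp: m assoc)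
  moreover have "reflp_on (carrier T) (sg_le T)"
    unfolding c reflp_on_def using ord_le_refl[OF ord] by (simp add: l)
  moreover have "antisymp_on (carrier T) (sg_le T)"
  proof -
    have "\<phi> x = \<phi> y" if "x \<in> carrier P" "y \<in> carrier P" "\<phi> x \<preceq>\<^bsub>T\<^esub> \<phi> y" "\<phi> y \<preceq>\<^bsub>T\<^esub> \<phi> x" for x y
      using that ord_le_antisym[OF ord that(1,2)] l by simp
    then show ?thesis unfolding c antisymp_on_def by blast
  qed
  moreover have "transp_on (carrier T) (sg_le T)"
  proof -
    have "\<phi> x \<preceq>\<^bsub>T\<^esub> \<phi> z" if "x \<in> carrier P" "y \<in> carrier P" "z \<in> carrier P"
      "\<phi> x \<preceq>\<^bsub>T\<^esub> \<phi> y" "\<phi> y \<preceq>\<^bsub>T\<^esub> \<phi> z" for x y z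
      using that ord_le_trans[OF ord that(1-3)] l by simp
    then show ?thesis unfolding c transp_on_def by blast
  qed
  ultimately have "ord_semigroup_str T"
    unfolding ord_semigroup_str_def c using ord_le_stable[OF ord] by (simp add: l m)
  moreover have "finite (carrier T)" using fin c by simp
  moreover have "\<phi> \<in> osg_iso P T"
    unfolding osg_iso_def sg_iso_def sg_hom_def using inj by (auto simp: bij_betw_def c m l)
  ultimately show ?thesis by (auto simp: finite_ord_semigroup_def)
qed

section \<open>Divisors of products, and generation of an orthogroup by its band and its
  groups\<close>

context
  fixes V :: "nat ord_semigrp set"
  assumes V: "ord_pseudovariety V"
begin

lemma opv_finite: "S \<in> V \<Longrightarrow> finite_ord_semigroup S"
  using V unfolding ord_pseudovariety_def by blast

lemma opv_hom:
  "S \<in> V \<Longrightarrow> finite_ord_semigroup T \<Longrightarrow> h \<in> osg_hom S T \<Longrightarrow> h ` carrier S = carrier T \<Longrightarrow> T \<in> V"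
  using V unfolding ord_pseudovariety_def by blast

lemma opv_sub: "S \<in> V \<Longrightarrow> subsemigroup A S \<Longrightarrow> S\<lparr>carrier := A\<rparr> \<in> V"
  using V unfolding ord_pseudovariety_def by blast

lemma opv_prod:
  "(\<And>i. i < (n :: nat) \<Longrightarrow> S i \<in> V) \<Longrightarrow> finite_ord_semigroup T \<Longrightarrow> h \<in> osg_iso (osg_prod {..<n} S) T \<Longrightarrow> T \<in> V"
  using V unfolding ord_pseudovariety_def by (metis empty_iff)

text \<open>Confines the transport to a copy on natural numbers to one place: later arguments work
  with subsemigroups of the product itself.\<close>

lemma opv_divisor:
  fixes n :: nat
  assumes S: "\<And>i. i < n \<Longrightarrow> S i \<in> V" and T: "finite_ord_semigroup T"
    and A: "subsemigroup A (osg_prod {..<n} S)"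
    and h: "h \<in> osg_hom ((osg_prod {..<n} S)\<lparr>carrier := A\<rparr>) T" "h ` A = carrier T"
  shows "T \<in> V"
proof -
  let ?P = "osg_prod {..<n} S"
  have "finite_ord_semigroup ?P" using S opv_finite by (intro osg_prod_finite_ord) auto
  then obtain Q :: "nat ord_semigrp" and \<phi> where Q: "finite_ord_semigroup Q" and \<phi>: "\<phi> \<in> osg_iso ?P Q"
    using ex_nat_copy by blast
  have "Q \<in> V" using opv_prod[OF S Q \<phi>] .
  have AP: "A \<subseteq> carrier ?P" and Am: "\<And>x y. x \<in> A \<Longrightarrow> y \<in> A \<Longrightarrow> x \<bullet>\<^bsub>?P\<^esub> y \<in> A" and Ane: "A \<noteq> {}"
    using A unfolding subsemigroup_def by auto
  have bij: "bij_betw \<phi> (carrier ?P) (carrier Q)" and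
    \<phi>c: "\<And>x. x \<in> carrier ?P \<Longrightarrow> \<phi> x \<in> carrier Q" and
    \<phi>m: "\<And>x y. x \<in> carrier ?P \<Longrightarrow> y \<in> carrier ?P \<Longrightarrow> \<phi> (x \<bullet>\<^bsub>?P\<^esub> y) = \<phi> x \<bullet>\<^bsub>Q\<^esub> \<phi> y" and
    \<phi>l: "\<And>x y. x \<in> carrier ?P \<Longrightarrow> y \<in> carrier ?P \<Longrightarrow> x \<preceq>\<^bsub>?P\<^esub> y \<longleftrightarrow> \<phi> x \<preceq>\<^bsub>Q\<^esub> \<phi> y"
    using \<phi> unfolding osg_iso_def sg_iso_def sg_hom_def by blast+
  have inj: "inj_on \<phi> (carrier ?P)" using bij by (rule bij_betw_imp_inj_on)
  define g where "g = h \<circ> inv_into (carrier ?P) \<phi>"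
  have g: "g (\<phi> x) = h x" if "x \<in> A" for x using that AP inj by (auto simp: g_def inv_into_f_f subset_iff)
  have \<phi>A: "\<phi> x \<bullet>\<^bsub>Q\<^esub> \<phi> y = \<phi> (x \<bullet>\<^bsub>?P\<^esub> y)" if "x \<in> A" "y \<in> A" for x y
    by (rule \<phi>m[symmetric]) (use that AP in blast)+
  have "\<phi> x \<bullet>\<^bsub>Q\<^esub> \<phi> y \<in> \<phi> ` A" if "x \<in> A" "y \<in> A" for x y
    unfolding \<phi>A[OF that] using Am[OF that] by (rule imageI)
  then have sub: "subsemigroup (\<phi> ` A) Q"
    unfolding subsemigroup_def using Ane AP \<phi>c by blast
  have hA: "\<And>x. x \<in> A \<Longrightarrow> h x \<in> carrier T"
    "\<And>x y. x \<in> A \<Longrightarrow> y \<in> A \<Longrightarrow> h (x \<bullet>\<^bsub>?P\<^esub> y) = h x \<bullet>\<^bsub>T\<^esub> h y"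
    "\<And>x y. x \<in> A \<Longrightarrow> y \<in> A \<Longrightarrow> x \<preceq>\<^bsub>?P\<^esub> y \<Longrightarrow> h x \<preceq>\<^bsub>T\<^esub> h y"
    using h(1) unfolding osg_hom_def sg_hom_def by (auto simp del: osg_prod_simps)
  have "g (\<phi> x \<bullet>\<^bsub>Q\<^esub> \<phi> y) = g (\<phi> x) \<bullet>\<^bsub>T\<^esub> g (\<phi> y)" if "x \<in> A" "y \<in> A" for x y
    unfolding \<phi>A[OF that] g[OF that(1)] g[OF that(2)] g[OF Am[OF that]] by (rule hA(2)[OF that])
  moreover have "g (\<phi> x) \<preceq>\<^bsub>T\<^esub> g (\<phi> y)" if "x \<in> A" "y \<in> A" "\<phi> x \<preceq>\<^bsub>Q\<^esub> \<phi> y" for x y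
  proof -
    have "x \<in> carrier ?P" "y \<in> carrier ?P" using that AP by blast+
    then have "x \<preceq>\<^bsub>?P\<^esub> y" using \<phi>l that(3) by blast
    then show ?thesis unfolding g[OF that(1)] g[OF that(2)] by (rule hA(3)[OF that(1,2)])
  qed
  ultimately have "g \<in> osg_hom (Q\<lparr>carrier := \<phi> ` A\<rparr>) T"
    unfolding osg_hom_def sg_hom_def using g hA(1) by auto
  moreover have "g ` carrier (Q\<lparr>carrier := \<phi> ` A\<rparr>) = carrier T"
    using g h(2) by (auto simp: image_image)
  ultimately show ?thesis using opv_hom[OF opv_sub[OF \<open>Q \<in> V\<close> sub] T] by blast
qed

text \<open>Write \<open>e \<sqsubseteq> a\<close> for \<open>e a e = e\<close>. The semigroup is covered by the set of all pairs of an idempotent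
  \<open>a\<close> and a family of elements of the maximal subgroups such that
  \<open>f (\<gamma> e) f = \<gamma> f\<close> whenever \<open>f \<sqsubseteq> e \<sqsubseteq> a\<close>, via \<open>(a, \<gamma>) \<mapsto> \<gamma> a\<close>. Since elements are natural numbers, they
  serve as indices of the maximal subgroups, and the idempotent is stored at an index \<open>N\<close> beyond the
  carrier.\<close>

lemma nocr_in_opv:
  assumes S: "finite_ord_semigroup S" and NO: "normal_orthogroup S"
    and E: "S\<lparr>carrier := idempotents S\<rparr> \<in> V"
    and G: "\<And>e. e \<in> idempotents S \<Longrightarrow> S\<lparr>carrier := units_at S e\<rparr> \<in> V"
  shows "S \<in> V"
proof -
  interpret nocr S using NO by (simp add: nocr_def)
  have ord: "ord_semigroup_str S" and fin: "finite (carrier S)"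
    using S by (auto simp: finite_ord_semigroup_def)
  obtain N where N: "carrier S \<subseteq> {..<N}"
    using fin finite_nat_set_iff_bounded by auto
  let ?E = "idempotents S"
  have EN: "e < Suc N" "e \<noteq> N" if "e \<in> ?E" for e
    using N idem_carrier[OF that] by auto
  have NE: "N \<notin> ?E" using EN by blast
  \<comment> \<open>Every index that is not an idempotent carries the band. This keeps all factors
    in \<open>V\<close>; among these indices only the coordinate \<open>N\<close> is ever
    read.\<close>
  define F where "F i = S\<lparr>carrier := if i \<in> ?E then units_at S i else ?E\<rparr>" for i
  let ?P = "osg_prod {..<Suc N} F"
  have FV: "F i \<in> V" for i using E G by (auto simp: F_def)
  have Fm [simp]: "sg_mult (F i) = sg_mult S" "sg_le (F i) = sg_le S" for i by (simp_all add: F_def)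
  have sgP: "sgrp ?P"
    using FV opv_finite by (intro ord_semigroup_sgrp osg_prod_ord) (auto simp: finite_ord_semigroup_def)
  \<comment> \<open>The condition ranges over all pairs \<open>f\<close>, \<open>e\<close> and not
    only over \<open>e = \<gamma> N\<close>. Closure under products can then be checked pair by pair
    with one use of \<open>compress_mult\<close>.\<close>
  define A where "A = {\<gamma> \<in> carrier ?P. \<forall>e\<in>?E. \<forall>f\<in>?E. f \<bullet>\<^bsub>S\<^esub> e \<bullet>\<^bsub>S\<^esub> f = f \<longrightarrow> e \<bullet>\<^bsub>S\<^esub> \<gamma> N \<bullet>\<^bsub>S\<^esub> e = e \<longrightarrow>
    f \<bullet>\<^bsub>S\<^esub> \<gamma> e \<bullet>\<^bsub>S\<^esub> f = \<gamma> f}"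
  have PE: "\<gamma> N \<in> ?E" if "\<gamma> \<in> carrier ?P" for \<gamma>
    using that NE by (auto simp: PiE_iff F_def dest!: bspec[where x=N])
  have PU: "\<gamma> e \<in> units_at S e" if "\<gamma> \<in> carrier ?P" "e \<in> ?E" for \<gamma> e
    using that EN(1)[OF that(2)] by (auto simp: PiE_iff F_def dest!: bspec[where x=e])
  have PC: "\<gamma> e \<in> carrier S" and PI: "idem_part S (\<gamma> e) = e"
    and PL: "e \<bullet>\<^bsub>S\<^esub> \<gamma> e = \<gamma> e" and PR: "\<gamma> e \<bullet>\<^bsub>S\<^esub> e = \<gamma> e" if "\<gamma> \<in> carrier ?P" "e \<in> ?E" for \<gamma> e
    using PU[OF that] idem_part_eq that by (auto elim: units_atE)
  have AP: "\<gamma> \<in> carrier ?P" if "\<gamma> \<in> A" for \<gamma> using that by (simp add: A_def)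
  have AC: "f \<bullet>\<^bsub>S\<^esub> \<gamma> e \<bullet>\<^bsub>S\<^esub> f = \<gamma> f"
    if "\<gamma> \<in> A" "e \<in> ?E" "f \<in> ?E" "f \<bullet>\<^bsub>S\<^esub> e \<bullet>\<^bsub>S\<^esub> f = f" "e \<bullet>\<^bsub>S\<^esub> \<gamma> N \<bullet>\<^bsub>S\<^esub> e = e" for \<gamma> e f
    using that unfolding A_def by blast
  have PM: "(\<gamma> \<bullet>\<^bsub>?P\<^esub> \<delta>) i = \<gamma> i \<bullet>\<^bsub>S\<^esub> \<delta> i" if "i < Suc N" for \<gamma> \<delta> i
    using that by simp
  define h where "h \<gamma> = \<gamma> (\<gamma> N)" for \<gamma> :: "nat \<Rightarrow> nat"
  have Amult: "\<gamma> \<bullet>\<^bsub>?P\<^esub> \<delta> \<in> A" if \<gamma>: "\<gamma> \<in> A" and \<delta>: "\<delta> \<in> A" for \<gamma> \<delta>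
  proof -
    note \<gamma>P = AP[OF \<gamma>] and \<delta>P = AP[OF \<delta>]
    have E2: "\<gamma> N \<in> ?E" "\<delta> N \<in> ?E" using PE \<gamma>P \<delta>P by auto
    have "f \<bullet>\<^bsub>S\<^esub> (\<gamma> e \<bullet>\<^bsub>S\<^esub> \<delta> e) \<bullet>\<^bsub>S\<^esub> f = \<gamma> f \<bullet>\<^bsub>S\<^esub> \<delta> f"
      if e: "e \<in> ?E" and f: "f \<in> ?E" and fe: "f \<bullet>\<^bsub>S\<^esub> e \<bullet>\<^bsub>S\<^esub> f = f"
        and ea: "e \<bullet>\<^bsub>S\<^esub> (\<gamma> N \<bullet>\<^bsub>S\<^esub> \<delta> N) \<bullet>\<^bsub>S\<^esub> e = e" for e f
    proof -
      \<comment> \<open>The product family is constrained only below the product of the stored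
        idempotents. That product lies below both factors, so both families are constrained there
        too.\<close>
      have "e \<bullet>\<^bsub>S\<^esub> \<gamma> N \<bullet>\<^bsub>S\<^esub> e = e" "e \<bullet>\<^bsub>S\<^esub> \<delta> N \<bullet>\<^bsub>S\<^esub> e = e"
        using below_trans[OF _ e _ ea] below_left[OF E2] below_right[OF E2] E2 by auto
      then have 1: "f \<bullet>\<^bsub>S\<^esub> \<gamma> e \<bullet>\<^bsub>S\<^esub> f = \<gamma> f" "f \<bullet>\<^bsub>S\<^esub> \<delta> e \<bullet>\<^bsub>S\<^esub> f = \<delta> f"
        using AC \<gamma> \<delta> e f fe by auto
      have c: "\<gamma> e \<in> carrier S" "\<delta> e \<in> carrier S" "f \<in> carrier S" "\<gamma> f \<in> carrier S"
        using PC e f \<gamma>P \<delta>P by auto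
      have "f \<bullet>\<^bsub>S\<^esub> (\<gamma> e \<bullet>\<^bsub>S\<^esub> \<delta> e) \<bullet>\<^bsub>S\<^esub> f = f \<bullet>\<^bsub>S\<^esub> \<gamma> e \<bullet>\<^bsub>S\<^esub> \<delta> e \<bullet>\<^bsub>S\<^esub> f"
        using c by (simp add: assoc)
      also have "\<dots> = f \<bullet>\<^bsub>S\<^esub> \<gamma> e \<bullet>\<^bsub>S\<^esub> f \<bullet>\<^bsub>S\<^esub> \<delta> e \<bullet>\<^bsub>S\<^esub> f"
        using compress_mult[OF f c(1,2)] PI \<gamma>P \<delta>P e fe by simp
      also have "\<dots> = \<gamma> f \<bullet>\<^bsub>S\<^esub> f \<bullet>\<^bsub>S\<^esub> \<delta> e \<bullet>\<^bsub>S\<^esub> f"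
        using 1 PR[OF \<gamma>P f] by simp
      also have "\<dots> = \<gamma> f \<bullet>\<^bsub>S\<^esub> (f \<bullet>\<^bsub>S\<^esub> \<delta> e \<bullet>\<^bsub>S\<^esub> f)" using c by (simp only: assoc closed)
      finally show ?thesis using 1 by simp
    qed
    then show ?thesis
      using sgrp.closed[OF sgP \<gamma>P \<delta>P] EN(1) unfolding A_def by (simp only: mem_Collect_eq PM lessI) (auto simp only: PM)
  qed
  have Asurj: "\<exists>\<gamma>\<in>A. h \<gamma> = s" if s: "s \<in> carrier S" for s
  proof -
    define a where "a = idem_part S s"
    have a: "a \<in> ?E" "a \<bullet>\<^bsub>S\<^esub> s = s" "s \<bullet>\<^bsub>S\<^esub> a = s" using s by (auto simp: a_def idem_part)
    \<comment> \<open>The preimage of \<open>s\<close> consists of its compressions at the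
      idempotents below \<open>a\<close>. Elsewhere the condition is void, and the identity
      \<open>i\<close> of the maximal subgroup is a default value; the index \<open>N\<close>
      receives \<open>a\<close>.\<close>
    define \<gamma> where "\<gamma> = (\<lambda>i\<in>{..<Suc N}. if i \<in> ?E then
      (if i \<bullet>\<^bsub>S\<^esub> a \<bullet>\<^bsub>S\<^esub> i = i then i \<bullet>\<^bsub>S\<^esub> s \<bullet>\<^bsub>S\<^esub> i else i) else a)"
    have \<gamma>N: "\<gamma> N = a" using NE by (simp add: \<gamma>_def)
    have \<gamma>e: "\<gamma> e = e \<bullet>\<^bsub>S\<^esub> s \<bullet>\<^bsub>S\<^esub> e" if "e \<in> ?E" "e \<bullet>\<^bsub>S\<^esub> a \<bullet>\<^bsub>S\<^esub> e = e" for e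
      using that EN(1)[OF that(1)] by (simp add: \<gamma>_def)
    have "\<gamma> \<in> carrier ?P"
      using compress_units_at[OF _ s] idem_units_at a(1) by (auto simp: \<gamma>_def F_def a_def)
    moreover have "f \<bullet>\<^bsub>S\<^esub> \<gamma> e \<bullet>\<^bsub>S\<^esub> f = \<gamma> f"
      if e: "e \<in> ?E" and f: "f \<in> ?E" and fe: "f \<bullet>\<^bsub>S\<^esub> e \<bullet>\<^bsub>S\<^esub> f = f" and ea: "e \<bullet>\<^bsub>S\<^esub> a \<bullet>\<^bsub>S\<^esub> e = e" for e f
    proof -
      have fa: "f \<bullet>\<^bsub>S\<^esub> a \<bullet>\<^bsub>S\<^esub> f = f" using below_trans[OF e f a(1) fe ea] .
      have c: "e \<in> carrier S" "f \<in> carrier S" "a \<in> carrier S" using e f a by auto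
      \<comment> \<open>Compression by \<open>f\<close> allows an \<open>f\<close> to be inserted
        between the factors of \<open>e s e\<close>, after which \<open>f e f = f\<close> collapses
        \<open>f e s e f\<close> to \<open>f s f\<close>. The right-hand \<open>e\<close> is removed
        here, the left-hand one further down.\<close>
      have 1: "f \<bullet>\<^bsub>S\<^esub> s \<bullet>\<^bsub>S\<^esub> f \<bullet>\<^bsub>S\<^esub> e \<bullet>\<^bsub>S\<^esub> f = f \<bullet>\<^bsub>S\<^esub> s \<bullet>\<^bsub>S\<^esub> e \<bullet>\<^bsub>S\<^esub> f"
        using e f fe fa s c by (intro compress_mult) (auto simp: a_def)
      have "f \<bullet>\<^bsub>S\<^esub> s \<bullet>\<^bsub>S\<^esub> f \<bullet>\<^bsub>S\<^esub> e \<bullet>\<^bsub>S\<^esub> f = f \<bullet>\<^bsub>S\<^esub> s \<bullet>\<^bsub>S\<^esub> (f \<bullet>\<^bsub>S\<^esub> e \<bullet>\<^bsub>S\<^esub> f)" using c s by (simp only: assoc closed)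
      with 1 have 2: "f \<bullet>\<^bsub>S\<^esub> s \<bullet>\<^bsub>S\<^esub> e \<bullet>\<^bsub>S\<^esub> f = f \<bullet>\<^bsub>S\<^esub> s \<bullet>\<^bsub>S\<^esub> f" unfolding fe by (rule trans[OF sym])
      have ip: "idem_part S (s \<bullet>\<^bsub>S\<^esub> e) = a \<bullet>\<^bsub>S\<^esub> e" using idem_part_mult[OF s c(1)] e by (simp add: a_def)
      have "f \<bullet>\<^bsub>S\<^esub> (a \<bullet>\<^bsub>S\<^esub> e) \<bullet>\<^bsub>S\<^esub> f = f \<bullet>\<^bsub>S\<^esub> a \<bullet>\<^bsub>S\<^esub> e \<bullet>\<^bsub>S\<^esub> f" using c by (simp add: assoc)
      also have "\<dots> = f \<bullet>\<^bsub>S\<^esub> a \<bullet>\<^bsub>S\<^esub> f \<bullet>\<^bsub>S\<^esub> e \<bullet>\<^bsub>S\<^esub> f"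
        using compress_mult[of f a e] e f a c fe fa by simp
      finally have 3: "f \<bullet>\<^bsub>S\<^esub> idem_part S (s \<bullet>\<^bsub>S\<^esub> e) \<bullet>\<^bsub>S\<^esub> f = f" using fa fe ip by simp
      have "f \<bullet>\<^bsub>S\<^esub> e \<bullet>\<^bsub>S\<^esub> f \<bullet>\<^bsub>S\<^esub> (s \<bullet>\<^bsub>S\<^esub> e) \<bullet>\<^bsub>S\<^esub> f = f \<bullet>\<^bsub>S\<^esub> e \<bullet>\<^bsub>S\<^esub> (s \<bullet>\<^bsub>S\<^esub> e) \<bullet>\<^bsub>S\<^esub> f"
        using e f fe s c 3 by (intro compress_mult) auto
      moreover have "f \<bullet>\<^bsub>S\<^esub> e \<bullet>\<^bsub>S\<^esub> (s \<bullet>\<^bsub>S\<^esub> e) \<bullet>\<^bsub>S\<^esub> f = f \<bullet>\<^bsub>S\<^esub> (e \<bullet>\<^bsub>S\<^esub> s \<bullet>\<^bsub>S\<^esub> e) \<bullet>\<^bsub>S\<^esub> f"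
        using c s by (simp only: assoc closed)
      moreover have "f \<bullet>\<^bsub>S\<^esub> (s \<bullet>\<^bsub>S\<^esub> e) \<bullet>\<^bsub>S\<^esub> f = f \<bullet>\<^bsub>S\<^esub> s \<bullet>\<^bsub>S\<^esub> e \<bullet>\<^bsub>S\<^esub> f" using c s by (simp only: assoc closed)
      ultimately show ?thesis using 2 fe \<gamma>e[OF e ea] \<gamma>e[OF f fa] by simp
    qed
    ultimately have "\<gamma> \<in> A" unfolding A_def mem_Collect_eq \<gamma>N by blast
    moreover have "h \<gamma> = s" unfolding h_def \<gamma>N using a \<gamma>e[of a] by simp
    ultimately show ?thesis by blast
  qed
  have hC: "h \<gamma> \<in> carrier S" if "\<gamma> \<in> A" for \<gamma>
    using PC[OF AP[OF that] PE[OF AP[OF that]]] by (simp add: h_def)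
  have hm: "h (\<gamma> \<bullet>\<^bsub>?P\<^esub> \<delta>) = h \<gamma> \<bullet>\<^bsub>S\<^esub> h \<delta>" if \<gamma>: "\<gamma> \<in> A" and \<delta>: "\<delta> \<in> A" for \<gamma> \<delta>
  proof -
    note \<gamma>P = AP[OF \<gamma>] and \<delta>P = AP[OF \<delta>]
    define a b where "a = \<gamma> N" and "b = \<delta> N"
    have ab: "a \<in> ?E" "b \<in> ?E" using PE \<gamma>P \<delta>P by (auto simp: a_def b_def)
    \<comment> \<open>The product is read at \<open>c\<close>, but the factors are read at
      \<open>a\<close> and \<open>b\<close>. Membership in \<open>A\<close> expresses the entries at
      \<open>c\<close> as compressions of the entries at \<open>a\<close> and \<open>b\<close>; by
      \<open>units_at_prod\<close> the outer \<open>c\<close> then disappears.\<close>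
    define c where "c = a \<bullet>\<^bsub>S\<^esub> b"
    have c: "c \<in> ?E" using ab by (simp add: c_def)
    have ca: "c \<bullet>\<^bsub>S\<^esub> a \<bullet>\<^bsub>S\<^esub> c = c" "c \<bullet>\<^bsub>S\<^esub> b \<bullet>\<^bsub>S\<^esub> c = c"
      using below_left[OF ab] below_right[OF ab] by (auto simp: c_def)
    have gd: "\<gamma> a \<in> carrier S" "\<delta> b \<in> carrier S" "c \<in> carrier S" using PC \<gamma>P \<delta>P ab c by auto
    have "h (\<gamma> \<bullet>\<^bsub>?P\<^esub> \<delta>) = (\<gamma> \<bullet>\<^bsub>?P\<^esub> \<delta>) c" unfolding h_def PM[OF lessI] c_def a_def b_def ..
    also have "\<dots> = \<gamma> c \<bullet>\<^bsub>S\<^esub> \<delta> c" using PM EN(1)[OF c] by blast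
    also have "\<gamma> c = c \<bullet>\<^bsub>S\<^esub> \<gamma> a \<bullet>\<^bsub>S\<^esub> c"
      by (rule AC[OF \<gamma> ab(1) c ca(1), symmetric]) (use ab in \<open>simp flip: a_def\<close>)
    also have "\<delta> c = c \<bullet>\<^bsub>S\<^esub> \<delta> b \<bullet>\<^bsub>S\<^esub> c"
      by (rule AC[OF \<delta> ab(2) c ca(2), symmetric]) (use ab in \<open>simp flip: b_def\<close>)
    also have "c \<bullet>\<^bsub>S\<^esub> \<gamma> a \<bullet>\<^bsub>S\<^esub> c \<bullet>\<^bsub>S\<^esub> (c \<bullet>\<^bsub>S\<^esub> \<delta> b \<bullet>\<^bsub>S\<^esub> c) = c \<bullet>\<^bsub>S\<^esub> \<gamma> a \<bullet>\<^bsub>S\<^esub> (c \<bullet>\<^bsub>S\<^esub> c) \<bullet>\<^bsub>S\<^esub> \<delta> b \<bullet>\<^bsub>S\<^esub> c"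
      using gd by (simp only: assoc closed)
    also have "\<dots> = c \<bullet>\<^bsub>S\<^esub> \<gamma> a \<bullet>\<^bsub>S\<^esub> c \<bullet>\<^bsub>S\<^esub> \<delta> b \<bullet>\<^bsub>S\<^esub> c" using c by simp
    also have "\<dots> = c \<bullet>\<^bsub>S\<^esub> \<gamma> a \<bullet>\<^bsub>S\<^esub> \<delta> b \<bullet>\<^bsub>S\<^esub> c"
      by (rule compress_mult) (use c gd ca PI \<gamma>P \<delta>P ab in auto)
    also have "\<dots> = c \<bullet>\<^bsub>S\<^esub> (\<gamma> a \<bullet>\<^bsub>S\<^esub> \<delta> b) \<bullet>\<^bsub>S\<^esub> c" using gd by (simp only: assoc closed)
    also have "\<dots> = \<gamma> a \<bullet>\<^bsub>S\<^esub> \<delta> b"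
      using units_at_prod[OF ab(1) PU[OF \<gamma>P ab(1)] ab(2) PU[OF \<delta>P ab(2)], folded c_def]
      by (auto elim: units_atE)
    finally show ?thesis unfolding h_def a_def b_def .
  qed
  have hl: "h \<gamma> \<preceq>\<^bsub>S\<^esub> h \<delta>" if \<gamma>: "\<gamma> \<in> A" and \<delta>: "\<delta> \<in> A" and le: "\<gamma> \<preceq>\<^bsub>?P\<^esub> \<delta>" for \<gamma> \<delta>
  proof -
    note \<gamma>P = AP[OF \<gamma>] and \<delta>P = AP[OF \<delta>]
    define a b where "a = \<gamma> N" and "b = \<delta> N"
    have ab: "a \<in> ?E" "b \<in> ?E" using PE \<gamma>P \<delta>P by (auto simp: a_def b_def)
    \<comment> \<open>Neither \<open>a\<close> nor \<open>b\<close> need be below the other in the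
      preorder of \<open>below_trans\<close>, so \<open>\<gamma> a\<close> and
      \<open>\<delta> b\<close> are compared through a coordinate below both: \<open>\<gamma> a
      \<le> \<gamma> c \<le> \<delta> c \<le> \<delta> b\<close>. The outer inequalities come from
      \<open>a \<le> c \<le> b\<close> and stability, the middle one from the product order.\<close>
    define c where "c = a \<bullet>\<^bsub>S\<^esub> b \<bullet>\<^bsub>S\<^esub> a"
    have c: "c \<in> ?E" using ab by (simp add: c_def)
    have cc: "a \<in> carrier S" "b \<in> carrier S" "c \<in> carrier S" using ab c by auto
    have "c \<bullet>\<^bsub>S\<^esub> a = c" using sandwich(3)[OF ab] by (simp add: c_def)
    then have ca: "c \<bullet>\<^bsub>S\<^esub> a \<bullet>\<^bsub>S\<^esub> c = c" using c by simp
    have "c \<bullet>\<^bsub>S\<^esub> b \<bullet>\<^bsub>S\<^esub> c = (a \<bullet>\<^bsub>S\<^esub> b) \<bullet>\<^bsub>S\<^esub> (a \<bullet>\<^bsub>S\<^esub> b) \<bullet>\<^bsub>S\<^esub> (a \<bullet>\<^bsub>S\<^esub> b) \<bullet>\<^bsub>S\<^esub> a"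
      unfolding c_def using cc by (simp only: assoc closed)
    then have cb: "c \<bullet>\<^bsub>S\<^esub> b \<bullet>\<^bsub>S\<^esub> c = c" using ab by (simp add: c_def)
    have le_i: "\<gamma> i \<preceq>\<^bsub>S\<^esub> \<delta> i" if "i < Suc N" for i using le that by simp
    have gd: "\<gamma> a \<in> carrier S" "\<delta> b \<in> carrier S" "\<gamma> c \<in> carrier S" "\<delta> c \<in> carrier S"
      using PC \<gamma>P \<delta>P ab c by auto
    have le_ab: "a \<preceq>\<^bsub>S\<^esub> b" using le_i[OF lessI] by (simp add: a_def b_def)
    note mono = ord_le_mult[OF ord] and refl = ord_le_refl[OF ord]
    have "a \<bullet>\<^bsub>S\<^esub> a \<bullet>\<^bsub>S\<^esub> a \<preceq>\<^bsub>S\<^esub> c" "c \<preceq>\<^bsub>S\<^esub> b \<bullet>\<^bsub>S\<^esub> b \<bullet>\<^bsub>S\<^esub> b"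
      unfolding c_def using cc le_ab refl by (auto intro!: mono)
    then have le_c: "a \<preceq>\<^bsub>S\<^esub> c" "c \<preceq>\<^bsub>S\<^esub> b" using ab by simp_all
    have "a \<bullet>\<^bsub>S\<^esub> \<gamma> a \<bullet>\<^bsub>S\<^esub> a \<preceq>\<^bsub>S\<^esub> c \<bullet>\<^bsub>S\<^esub> \<gamma> a \<bullet>\<^bsub>S\<^esub> c" using cc gd le_c refl by (auto intro!: mono)
    moreover have "a \<bullet>\<^bsub>S\<^esub> \<gamma> a \<bullet>\<^bsub>S\<^esub> a = \<gamma> a" using PL PR \<gamma>P ab by simp
    moreover have "c \<bullet>\<^bsub>S\<^esub> \<gamma> a \<bullet>\<^bsub>S\<^esub> c = \<gamma> c"
      by (rule AC[OF \<gamma> ab(1) c ca]) (use ab in \<open>simp flip: a_def\<close>)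
    ultimately have 1: "\<gamma> a \<preceq>\<^bsub>S\<^esub> \<gamma> c" by simp
    have 2: "\<gamma> c \<preceq>\<^bsub>S\<^esub> \<delta> c" using le_i EN(1)[OF c] by blast
    have "c \<bullet>\<^bsub>S\<^esub> \<delta> b \<bullet>\<^bsub>S\<^esub> c \<preceq>\<^bsub>S\<^esub> b \<bullet>\<^bsub>S\<^esub> \<delta> b \<bullet>\<^bsub>S\<^esub> b" using cc gd le_c refl by (auto intro!: mono)
    moreover have "b \<bullet>\<^bsub>S\<^esub> \<delta> b \<bullet>\<^bsub>S\<^esub> b = \<delta> b" using PL PR \<delta>P ab by simp
    moreover have "c \<bullet>\<^bsub>S\<^esub> \<delta> b \<bullet>\<^bsub>S\<^esub> c = \<delta> c"
      by (rule AC[OF \<delta> ab(2) c cb]) (use ab in \<open>simp flip: b_def\<close>)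
    ultimately have 3: "\<delta> c \<preceq>\<^bsub>S\<^esub> \<delta> b" by simp
    have "\<gamma> a \<preceq>\<^bsub>S\<^esub> \<delta> b"
      using ord_le_trans[OF ord gd(1,3,4) 1 2] ord_le_trans[OF ord _ _ _ _ 3] gd by blast
    then show ?thesis by (simp add: h_def a_def b_def)
  qed
  show ?thesis
  proof (rule opv_divisor[OF FV S])
    have "A \<noteq> {}" using Asurj nonempty by blast
    then show "subsemigroup A ?P" unfolding subsemigroup_def using AP Amult by blast
    show "h \<in> osg_hom (?P\<lparr>carrier := A\<rparr>) S"
      unfolding osg_hom_def sg_hom_def using hC hm hl by (simp del: osg_prod_simps)
    show "h ` A = carrier S" using hC Asurj by blast
  qed
qed

end

section \<open>Groups\<close>

lemma group_on_restrict: "K \<subseteq> A \<Longrightarrow> A \<subseteq> carrier S \<Longrightarrow> group_on (S\<lparr>carrier := A\<rparr>) K \<longleftrightarrow> group_on S K"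
  by (auto simp: group_on_def)

text \<open>Some power of each element is idempotent and hence equals \<open>e\<close>; the
  preceding power is an inverse, unless the element is \<open>e\<close> already.\<close>

lemma finite_group_onI:
  assumes S: "semigroup_str S" and A: "subsemigroup A S" "finite A"
    and e: "e \<in> A" "\<And>x. x \<in> A \<Longrightarrow> e \<bullet>\<^bsub>S\<^esub> x = x \<and> x \<bullet>\<^bsub>S\<^esub> e = x"
    and unique: "\<And>f. f \<in> A \<Longrightarrow> f \<in> idempotents S \<Longrightarrow> f = e"
  shows "group_on S A"
proof -
  interpret sgrp S using S by (simp add: sgrp_def)
  have AS: "A \<subseteq> carrier S" using A by (simp add: subsemigroup_def)
  interpret A: sgrp "S\<lparr>carrier := A\<rparr>" using subsemigroup_sgrp[OF S A(1)] by (simp add: sgrp_def)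
  have "\<exists>y\<in>A. x \<bullet>\<^bsub>S\<^esub> y = e \<and> y \<bullet>\<^bsub>S\<^esub> x = e" if x: "x \<in> A" for x
  proof -
    have sp: "spow (S\<lparr>carrier := A\<rparr>) x n = spow S x n" for n by (induction n) simp_all
    have xS: "x \<in> carrier S" using AS x by blast
    obtain n where "spow S x n \<in> idempotents (S\<lparr>carrier := A\<rparr>)"
      using A.ex_idempotent_power[of x] A(2) x unfolding sp by auto
    then have n: "spow S x n = e" using unique AS by (auto simp: idempotents_sub)
    show ?thesis
    proof (cases n)
      case 0
      then show ?thesis using n e by auto
    next
      case (Suc m)
      have "spow S x 0 \<bullet>\<^bsub>S\<^esub> spow S x m = e" "spow S x m \<bullet>\<^bsub>S\<^esub> spow S x 0 = e"
        using n Suc xS by (simp_all only: spow_mult) simp_all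
      then show ?thesis using spow_subsemigroup[OF A(1) x] by auto
    qed
  qed
  then show ?thesis
    unfolding group_on_iff[OF S AS] using A(1) e unfolding subsemigroup_def by blast
qed

text \<open>Groups become a special case of normal orthogroups, so that subsemigroups and products
  of groups can be treated with the closure properties already available for orthogroups.\<close>

lemma group_iff_unique_idempotent:
  assumes S: "semigroup_str S"
  shows "group_on S (carrier S) \<longleftrightarrow> normal_orthogroup S \<and> (\<exists>e. idempotents S = {e})"
proof
  interpret sgrp S using S by (simp add: sgrp_def)
  assume G: "group_on S (carrier S)"
  then obtain e where e: "e \<in> idempotents S" "carrier S \<subseteq> units_at S e"
    by (rule group_on_sub_units_at)
  have "f = e" if "f \<in> idempotents S" for f
    using idem_units_at[OF that] that e by (intro units_at_unique[of f]) (auto simp: idempotents_def)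
  then have E: "idempotents S = {e}" using e by blast
  have "completely_regular S" using S G by (auto simp: completely_regular_def)
  then have "\<forall>x\<in>carrier S. \<exists>y\<in>carrier S. x \<bullet>\<^bsub>S\<^esub> y = y \<bullet>\<^bsub>S\<^esub> x \<and> x \<bullet>\<^bsub>S\<^esub> y \<bullet>\<^bsub>S\<^esub> x = x"
    unfolding completely_regular_iff by blast
  moreover have "e \<bullet>\<^bsub>S\<^esub> e = e" using e by (simp add: idempotents_def)
  ultimately show "normal_orthogroup S \<and> (\<exists>e. idempotents S = {e})"
    using S E unfolding normal_orthogroup_iff by simp
next
  assume *: "normal_orthogroup S \<and> (\<exists>e. idempotents S = {e})"
  then interpret nocr S by (simp add: nocr_def)
  obtain e where e: "idempotents S = {e}" using * by blast
  have "carrier S = units_at S e" using ex_units_at e by (auto elim: units_atE)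
  then show "group_on S (carrier S)" using group_on_units_at[of e] e by simp
qed

lemma group_on_image:
  assumes S: "semigroup_str S" and T: "semigroup_str T" and h: "h \<in> sg_hom S T" and K: "group_on S K"
  shows "group_on T (h ` K)"
proof -
  have KS: "K \<subseteq> carrier S" using K by (simp add: group_on_def)
  have hK: "h ` K \<subseteq> carrier T" using h KS by (auto simp: sg_hom_def)
  have m: "h x \<bullet>\<^bsub>T\<^esub> h y = h (x \<bullet>\<^bsub>S\<^esub> y)" if "x \<in> K" "y \<in> K" for x y
    using sg_hom_mult[OF h] that KS by (metis subsetD)
  obtain e where e: "e \<in> K" and
    *: "\<And>x. x \<in> K \<Longrightarrow> e \<bullet>\<^bsub>S\<^esub> x = x \<and> x \<bullet>\<^bsub>S\<^esub> e = x \<and> (\<exists>y\<in>K. x \<bullet>\<^bsub>S\<^esub> y = e \<and> y \<bullet>\<^bsub>S\<^esub> x = e)"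
    using K unfolding group_on_iff[OF S KS] by blast
  have closed: "\<And>x y. x \<in> K \<Longrightarrow> y \<in> K \<Longrightarrow> x \<bullet>\<^bsub>S\<^esub> y \<in> K"
    using K unfolding group_on_iff[OF S KS] by blast
  have "h e \<bullet>\<^bsub>T\<^esub> h x = h x \<and> h x \<bullet>\<^bsub>T\<^esub> h e = h x \<and> (\<exists>y\<in>K. h x \<bullet>\<^bsub>T\<^esub> h y = h e \<and> h y \<bullet>\<^bsub>T\<^esub> h x = h e)"
    if x: "x \<in> K" for x
  proof -
    obtain y where y: "y \<in> K" "x \<bullet>\<^bsub>S\<^esub> y = e" "y \<bullet>\<^bsub>S\<^esub> x = e" using * x by blast
    have "h x \<bullet>\<^bsub>T\<^esub> h y = h e \<and> h y \<bullet>\<^bsub>T\<^esub> h x = h e" using m x y by simp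
    then show ?thesis using m[OF e x] m[OF x e] *[OF x] y(1) by auto
  qed
  then show ?thesis unfolding group_on_iff[OF T hK] using e m closed by simp blast
qed

text \<open>A minimal subsemigroup \<open>P\<close> mapped onto a group coincides with \<open>e P e\<close> for each of its idempotents
  \<open>e\<close>, so it has only one idempotent.\<close>

lemma lift_group:
  assumes S: "semigroup_str S" "finite (carrier S)" and T: "semigroup_str T"
    and h: "h \<in> sg_hom S T" and K: "group_on T K" "K \<subseteq> h ` carrier S"
  obtains L where "group_on S L" "h ` L = K"
proof -
  interpret sgrp S using S by (simp add: sgrp_def)
  interpret T: sgrp T using T by (simp add: sgrp_def)
  have KT: "subsemigroup K T" using K T group_on_subsemigroup by blast
  obtain k where k: "k \<in> K" "k \<in> idempotents T" "K \<subseteq> units_at T k"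
    using K(1) by (rule T.group_on_sub_units_at)
  let ?Q = "\<lambda>P. subsemigroup P S \<and> h ` P = K"
  have "?Q {x \<in> carrier S. h x \<in> K}"
    using KT K(2) sg_hom_mult[OF h] by (auto simp: subsemigroup_def)
  from ex_has_least_nat[of ?Q, OF this, of card]
  obtain P where *: "?Q P \<and> (\<forall>P'. ?Q P' \<longrightarrow> card P \<le> card P')" by (elim exE)
  then have P: "?Q P" and min: "\<And>P'. ?Q P' \<Longrightarrow> card P \<le> card P'" by simp_all
  have PS: "P \<subseteq> carrier S" and Pm: "\<And>x y. x \<in> P \<Longrightarrow> y \<in> P \<Longrightarrow> x \<bullet>\<^bsub>S\<^esub> y \<in> P"
    and hP: "h ` P = K"
    using P by (auto simp: subsemigroup_def)
  have finP: "finite P" using PS S(2) finite_subset by blast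
  have id: "e \<bullet>\<^bsub>S\<^esub> x = x \<and> x \<bullet>\<^bsub>S\<^esub> e = x" if e: "e \<in> P" "e \<in> idempotents S" and x: "x \<in> P" for e x
  proof -
    let ?P = "(\<lambda>p. e \<bullet>\<^bsub>S\<^esub> p \<bullet>\<^bsub>S\<^esub> e) ` P"
    have eS: "e \<in> carrier S" "e \<bullet>\<^bsub>S\<^esub> e = e" using e by (auto simp: idempotents_def)
    have he: "h e \<in> idempotents T" "h e \<in> K" using sg_hom_idem[OF h e(2)] hP e by auto
    \<comment> \<open>An idempotent of the group \<open>K\<close> is its identity. Multiplying by
      \<open>e\<close> on both sides therefore leaves images unchanged, and \<open>e P e\<close> is
      again a candidate to which minimality applies.\<close>
    have hek: "h e = k"
      using T.idem_units_at[OF he(1)] he k(2,3) by (intro T.units_at_unique[of "h e"]) (auto simp: idempotents_def)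
    have "(e \<bullet>\<^bsub>S\<^esub> p \<bullet>\<^bsub>S\<^esub> e) \<bullet>\<^bsub>S\<^esub> (e \<bullet>\<^bsub>S\<^esub> q \<bullet>\<^bsub>S\<^esub> e) \<in> ?P" if "p \<in> P" "q \<in> P" for p q
    proof -
      have c: "p \<in> carrier S" "q \<in> carrier S" using that PS by auto
      have "(e \<bullet>\<^bsub>S\<^esub> p \<bullet>\<^bsub>S\<^esub> e) \<bullet>\<^bsub>S\<^esub> (e \<bullet>\<^bsub>S\<^esub> q \<bullet>\<^bsub>S\<^esub> e) = e \<bullet>\<^bsub>S\<^esub> (p \<bullet>\<^bsub>S\<^esub> e \<bullet>\<^bsub>S\<^esub> (e \<bullet>\<^bsub>S\<^esub> q)) \<bullet>\<^bsub>S\<^esub> e"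
        using c eS(1) by (simp only: assoc closed)
      then show ?thesis using Pm e that by auto
    qed
    moreover have sub: "?P \<subseteq> P" using Pm e by auto
    moreover have "h (e \<bullet>\<^bsub>S\<^esub> p \<bullet>\<^bsub>S\<^esub> e) = h p" if p: "p \<in> P" for p
    proof -
      have "h p \<in> units_at T k" using k(3) hP p by blast
      then have "k \<bullet>\<^bsub>T\<^esub> h p = h p" "h p \<bullet>\<^bsub>T\<^esub> k = h p" by (auto elim: units_atE)
      moreover have "h (e \<bullet>\<^bsub>S\<^esub> p \<bullet>\<^bsub>S\<^esub> e) = h e \<bullet>\<^bsub>T\<^esub> h p \<bullet>\<^bsub>T\<^esub> h e"
        using sg_hom_mult[OF h] eS(1) p PS by (simp add: subset_iff)
      ultimately show ?thesis using hek by simp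
    qed
    ultimately have "?Q ?P" using PS e(1) hP by (auto simp: subsemigroup_def image_image)
    then have "?P = P" using min sub finP by (intro card_seteq) auto
    then obtain p where p: "p \<in> P" "x = e \<bullet>\<^bsub>S\<^esub> p \<bullet>\<^bsub>S\<^esub> e" using x by blast
    have pS: "p \<in> carrier S" using p PS by blast
    have "e \<bullet>\<^bsub>S\<^esub> x = e \<bullet>\<^bsub>S\<^esub> e \<bullet>\<^bsub>S\<^esub> p \<bullet>\<^bsub>S\<^esub> e" "x \<bullet>\<^bsub>S\<^esub> e = e \<bullet>\<^bsub>S\<^esub> p \<bullet>\<^bsub>S\<^esub> (e \<bullet>\<^bsub>S\<^esub> e)"
      unfolding p(2) using pS eS(1) by (simp_all only: assoc closed)
    then show ?thesis using p(2) eS(2) by simp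
  qed
  obtain e where e: "e \<in> P" "e \<in> idempotents S"
    using ex_idempotent_subsemigroup[OF S(1) _ finP] P by blast
  have "f = e" if "f \<in> P" "f \<in> idempotents S" for f
    using id[OF e that(1)] id[OF that e(1)] by simp
  then have "group_on S P" using finite_group_onI[OF S(1) _ finP e(1)] id[OF e] P by blast
  then show ?thesis using hP that by blast
qed

text \<open>Multiplying \<open>x \<le> y\<close> by the inverse \<open>z\<close> of \<open>x\<close>
  gives \<open>e \<le> g\<close> with \<open>g = z y\<close>. By stability
  \<open>g \<le> g^2 \<le> ...\<close>, and some power of \<open>g\<close> equals \<open>e\<close>,
  so \<open>g = e\<close> by antisymmetry.\<close>

lemma ord_group_discrete:
  assumes S: "finite_ord_semigroup S" and G: "group_on S (carrier S)"
    and c: "x \<in> carrier S" "y \<in> carrier S" and le: "x \<preceq>\<^bsub>S\<^esub> y"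
  shows "x = y"
proof -
  have ord: "ord_semigroup_str S" and fin: "finite (carrier S)"
    using S by (auto simp: finite_ord_semigroup_def)
  interpret sgrp S using ord by (rule ord_semigroup_sgrp)
  obtain e where eE: "idempotents S = {e}"
    using G group_iff_unique_idempotent[OF semigroup_str] by blast
  obtain f where f: "f \<in> idempotents S" "carrier S \<subseteq> units_at S f" using G by (rule group_on_sub_units_at)
  have e: "e \<in> carrier S" "carrier S \<subseteq> units_at S e" using eE f by (auto simp: idempotents_def)
  have unit: "e \<bullet>\<^bsub>S\<^esub> u = u" "u \<bullet>\<^bsub>S\<^esub> e = u" if "u \<in> carrier S" for u
    using e(2) that by (auto elim: units_atE)
  obtain z where z: "z \<in> carrier S" "z \<bullet>\<^bsub>S\<^esub> x = e" "x \<bullet>\<^bsub>S\<^esub> z = e" using e(2) c by (auto elim: units_atE)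
  let ?g = "z \<bullet>\<^bsub>S\<^esub> y"
  have g: "?g \<in> carrier S" using z c by simp
  have eg: "e \<preceq>\<^bsub>S\<^esub> ?g" using ord_le_stable[OF ord c z(1) le] z(2) by simp
  have "?g \<preceq>\<^bsub>S\<^esub> spow S ?g n" for n
  proof (induction n)
    case 0
    then show ?case using ord_le_refl[OF ord g] by simp
  next
    case (Suc n)
    have "spow S ?g n \<preceq>\<^bsub>S\<^esub> spow S ?g (Suc n)"
      using ord_le_stable[OF ord e(1) g spow_closed[OF g, of n] eg] unit[OF spow_closed[OF g, of n]] by simp
    with Suc show ?case by (rule ord_le_trans[OF ord g spow_closed[OF g] spow_closed[OF g]])
  qed
  moreover obtain n where "spow S ?g n = e" using ex_idempotent_power[OF fin g] eE by auto
  ultimately have "?g \<preceq>\<^bsub>S\<^esub> e" by metis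
  then have "?g = e" using ord_le_antisym[OF ord g e(1)] eg by blast
  then have "x \<bullet>\<^bsub>S\<^esub> ?g = x" using unit c by simp
  moreover have "x \<bullet>\<^bsub>S\<^esub> ?g = y" using assoc[OF c(1) z(1) c(2)] z(3) unit c by simp
  ultimately show ?thesis by simp
qed

section \<open>Operations on pseudovarieties\<close>

lemma truncate_simps [simp]:
  "carrier (semigrp.truncate S) = carrier S" "sg_mult (semigrp.truncate S) = sg_mult S"
  by (simp_all add: semigrp.truncate_def)

lemma truncate_sub: "semigrp.truncate (S\<lparr>carrier := A\<rparr>) = (semigrp.truncate S)\<lparr>carrier := A\<rparr>"
  by (simp add: semigrp.truncate_def)

lemma truncate_iffs [simp]:
  "semigroup_str (semigrp.truncate S) \<longleftrightarrow> semigroup_str S"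
  "finite_semigroup (semigrp.truncate S) \<longleftrightarrow> finite_semigroup S"
  "subsemigroup A (semigrp.truncate S) \<longleftrightarrow> subsemigroup A S"
  "group_on (semigrp.truncate S) A \<longleftrightarrow> group_on S A"
  "normal_band (semigrp.truncate S) \<longleftrightarrow> normal_band S"
  "idempotents (semigrp.truncate S) = idempotents S"
  "normal_orthogroup (semigrp.truncate S) \<longleftrightarrow> normal_orthogroup S"
  by (simp_all add: semigroup_str_def finite_semigroup_def subsemigroup_def group_on_def
      normal_band_def idempotents_def normal_orthogroup_iff)

lemma finite_ord_semigroup_finite: "finite_ord_semigroup S \<Longrightarrow> finite_semigroup S"
  by (simp add: finite_ord_semigroup_def ord_semigroup_str_def finite_semigroup_def)

lemma with_all_orders_iff:
  "S \<in> with_all_orders \<N>\<O>\<C>\<R> \<longleftrightarrow> finite_ord_semigroup S \<and> normal_orthogroup S"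
  "S \<in> with_all_orders \<N>\<B> \<longleftrightarrow> finite_ord_semigroup S \<and> normal_band S"
  by (auto simp: with_all_orders_def pv_NOCR_def pv_NB_def finite_ord_semigroup_finite)

text \<open>By \<open>ord_group_discrete\<close> this is the only way to order a finite group
  stably, so it serves as the ordered representative of an unordered group.\<close>

definition discrete :: "('a, 'm) semigrp_scheme \<Rightarrow> 'a ord_semigrp" where
  "discrete G = \<lparr> carrier = carrier G, sg_mult = sg_mult G, sg_le = (=) \<rparr>"

lemma discrete_simps [simp]:
  "carrier (discrete G) = carrier G" "sg_mult (discrete G) = sg_mult G" "sg_le (discrete G) = (=)"
  by (simp_all add: discrete_def)

lemma discrete_iff:
  "idempotents (discrete G) = idempotents G"
  "group_on (discrete G) K \<longleftrightarrow> group_on G K"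
  "normal_orthogroup (discrete G) \<longleftrightarrow> normal_orthogroup G"
  "subsemigroup K (discrete G) \<longleftrightarrow> subsemigroup K G"
  by (simp_all add: idempotents_def group_on_def normal_orthogroup_iff semigroup_str_def subsemigroup_def)

lemma discrete_sub: "discrete (G\<lparr>carrier := A\<rparr>) = (discrete G)\<lparr>carrier := A\<rparr>"
  by (simp add: discrete_def)

lemma truncate_discrete: "semigrp.truncate (discrete G) = (G :: 'a semigrp)"
  by (simp add: semigrp.truncate_def discrete_def)

lemma finite_discrete: "finite_semigroup G \<Longrightarrow> finite_ord_semigroup (discrete G)"
  by (simp add: finite_semigroup_def finite_ord_semigroup_def ord_semigroup_str_def semigroup_str_def
      reflp_on_def antisymp_on_def transp_on_def)

lemma ord_pseudovarietyI:
  assumes "\<And>S. S \<in> V \<Longrightarrow> finite_ord_semigroup S"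
    and "\<And>S T h. S \<in> V \<Longrightarrow> finite_ord_semigroup T \<Longrightarrow> h \<in> osg_hom S T \<Longrightarrow> h ` carrier S = carrier T \<Longrightarrow> T \<in> V"
    and "\<And>S A. S \<in> V \<Longrightarrow> subsemigroup A S \<Longrightarrow> S\<lparr>carrier := A\<rparr> \<in> V"
    and "\<And>(n :: nat) S T h. (\<And>i. i < n \<Longrightarrow> S i \<in> V) \<Longrightarrow> finite_ord_semigroup T \<Longrightarrow>
      h \<in> osg_iso (osg_prod {..<n} S) T \<Longrightarrow> T \<in> V"
  shows "ord_pseudovariety V"
  unfolding ord_pseudovariety_def using assms by blast

lemma pseudovarietyI:
  assumes "\<And>S. S \<in> V \<Longrightarrow> finite_semigroup S"
    and "\<And>S T h. S \<in> V \<Longrightarrow> finite_semigroup T \<Longrightarrow> h \<in> sg_hom S T \<Longrightarrow> h ` carrier S = carrier T \<Longrightarrow> T \<in> V"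
    and "\<And>S A. S \<in> V \<Longrightarrow> subsemigroup A S \<Longrightarrow> S\<lparr>carrier := A\<rparr> \<in> V"
    and "\<And>(n :: nat) S T h. (\<And>i. i < n \<Longrightarrow> S i \<in> V) \<Longrightarrow> finite_semigroup T \<Longrightarrow>
      h \<in> sg_iso (sg_prod {..<n} S) T \<Longrightarrow> T \<in> V"
  shows "pseudovariety V"
  unfolding pseudovariety_def using assms by blast

lemma pv_hom:
  "pseudovariety V \<Longrightarrow> S \<in> V \<Longrightarrow> finite_semigroup T \<Longrightarrow> h \<in> sg_hom S T \<Longrightarrow> h ` carrier S = carrier T \<Longrightarrow> T \<in> V"
  unfolding pseudovariety_def by blast

lemma pv_sub: "pseudovariety V \<Longrightarrow> S \<in> V \<Longrightarrow> subsemigroup A S \<Longrightarrow> S\<lparr>carrier := A\<rparr> \<in> V"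
  unfolding pseudovariety_def by blast

lemma pv_prod:
  "pseudovariety V \<Longrightarrow> (\<And>i. i < (n :: nat) \<Longrightarrow> S i \<in> V) \<Longrightarrow> finite_semigroup T \<Longrightarrow>
    h \<in> sg_iso (sg_prod {..<n} S) T \<Longrightarrow> T \<in> V"
  unfolding pseudovariety_def by (metis empty_iff)

lemma ord_pseudovariety_Inter:
  assumes "\<V> \<noteq> {}" and V: "\<And>V. V \<in> \<V> \<Longrightarrow> ord_pseudovariety V"
  shows "ord_pseudovariety (\<Inter>\<V>)"
proof (rule ord_pseudovarietyI)
  show "finite_ord_semigroup S" if "S \<in> \<Inter>\<V>" for S
    using assms(1) that opv_finite[OF V] by blast
  show "T \<in> \<Inter>\<V>"
    if "S \<in> \<Inter>\<V>" "finite_ord_semigroup T" "h \<in> osg_hom S T" "h ` carrier S = carrier T" for S T h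
    using opv_hom[OF V _ that(2,3,4)] that(1) by blast
  show "S\<lparr>carrier := A\<rparr> \<in> \<Inter>\<V>" if "S \<in> \<Inter>\<V>" "subsemigroup A S" for S A
    using opv_sub[OF V _ that(2)] that(1) by blast
  show "T \<in> \<Inter>\<V>" if S: "\<And>i. i < n \<Longrightarrow> S i \<in> \<Inter>\<V>" and T: "finite_ord_semigroup T"
    "h \<in> osg_iso (osg_prod {..<n} S) T" for n :: nat and S T h
  proof
    fix V' assume "V' \<in> \<V>"
    then show "T \<in> V'" using S by (intro opv_prod[OF V _ T]) auto
  qed
qed

lemma ord_pseudovariety_Int:
  assumes "ord_pseudovariety V" "ord_pseudovariety W"
  shows "ord_pseudovariety (V \<inter> W)"
proof -
  have "ord_pseudovariety (\<Inter>{V, W})" using assms by (intro ord_pseudovariety_Inter) auto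
  then show ?thesis by simp
qed

lemma ord_pseudovariety_with_all_orders:
  assumes U: "pseudovariety U"
  shows "ord_pseudovariety (with_all_orders U)"
proof (rule ord_pseudovarietyI)
  show "finite_ord_semigroup S" if "S \<in> with_all_orders U" for S
    using that by (simp add: with_all_orders_def)
  show "T \<in> with_all_orders U"
    if "S \<in> with_all_orders U" "finite_ord_semigroup T" "h \<in> osg_hom S T" "h ` carrier S = carrier T" for S T h
  proof -
    have h: "h \<in> sg_hom (semigrp.truncate S) (semigrp.truncate T)"
      using that(3) by (simp add: osg_hom_def sg_hom_def)
    have "semigrp.truncate S \<in> U" using that(1) by (simp add: with_all_orders_def)
    then have "semigrp.truncate T \<in> U"
      by (rule pv_hom[OF U _ _ h]) (use that(2,4) finite_ord_semigroup_finite in simp_all)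
    then show ?thesis using that by (simp add: with_all_orders_def)
  qed
  show "S\<lparr>carrier := A\<rparr> \<in> with_all_orders U" if "S \<in> with_all_orders U" "subsemigroup A S" for S A
  proof -
    have "(semigrp.truncate S)\<lparr>carrier := A\<rparr> \<in> U"
      by (rule pv_sub[OF U]) (use that in \<open>simp_all add: with_all_orders_def\<close>)
    then show ?thesis using that finite_subsemigroup_ord[of S A] by (simp add: with_all_orders_def truncate_sub)
  qed
  show "T \<in> with_all_orders U"
    if S: "\<And>i. i < n \<Longrightarrow> S i \<in> with_all_orders U" and T: "finite_ord_semigroup T"
      "h \<in> osg_iso (osg_prod {..<n} S) T" for n :: nat and S T h
  proof -
    have h: "h \<in> sg_iso (sg_prod {..<n} (\<lambda>i. semigrp.truncate (S i))) (semigrp.truncate T)"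
      using T(2) by (simp add: osg_iso_def sg_iso_def sg_hom_def sg_prod_def)
    have "semigrp.truncate T \<in> U"
      by (rule pv_prod[OF U _ _ h]) (use S T finite_ord_semigroup_finite in \<open>simp_all add: with_all_orders_def\<close>)
    then show ?thesis using T by (simp add: with_all_orders_def)
  qed
qed

lemma trivial_in_opv:
  assumes V: "ord_pseudovariety V" and T: "finite_ord_semigroup T" "carrier T = {e}"
  shows "T \<in> V"
proof -
  have "e \<bullet>\<^bsub>T\<^esub> e = e" "e \<preceq>\<^bsub>T\<^esub> e"
    using T by (simp_all add: finite_ord_semigroup_def ord_semigroup_str_def semigroup_str_def reflp_on_def)
  \<comment> \<open>The product of no factors has exactly one element, so trivial semigroups are
    obtained without any member of \<open>V\<close> at hand.\<close>
  then have "(\<lambda>_. e) \<in> osg_iso (osg_prod {..<0 :: nat} (\<lambda>_. T)) T"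
    using T by (simp add: osg_iso_def sg_iso_def sg_hom_def bij_betw_def)
  then show ?thesis by (rule opv_prod[OF V _ T(1), rotated]) simp
qed

text \<open>The second component of the isomorphism. It collects unordered groups because its values
  belong to the lattice of pseudovarieties of semigroups.\<close>

definition pv_groups :: "nat ord_semigrp set \<Rightarrow> nat semigrp set" where
  "pv_groups V = {G \<in> \<G>. discrete G \<in> V}"

text \<open>Since idempotents lift, an image of an orthogroup with one idempotent has one
  idempotent. This recognizes isomorphic copies of products of groups as groups.\<close>

lemma unique_idempotent_hom:
  assumes S: "normal_orthogroup S" "\<exists>e. idempotents S = {e}" and T: "semigroup_str T"
    and h: "h \<in> sg_hom S T" "h ` carrier S = carrier T"
  shows "group_on T (carrier T)"
proof -
  interpret nocr S using S by (simp add: nocr_def)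
  obtain e where e: "idempotents S = {e}" using S by blast
  have "h e \<in> idempotents T" using sg_hom_idem[OF h(1), of e] e by simp
  moreover have "f = h e" if "f \<in> idempotents T" for f
    using lift_idempotent[OF h T that] e by auto
  ultimately have "idempotents T = {h e}" by blast
  then show ?thesis
    using group_iff_unique_idempotent[OF T] normal_orthogroup_hom[OF S(1) T h] by blast
qed

text \<open>A subsemigroup of a finite group contains the only idempotent and is therefore a group.
  For products, the coordinatewise order built from equalities is again equality, so discrete copies
  and products match.\<close>

lemma pseudovariety_pv_groups:
  assumes V: "ord_pseudovariety V"
  shows "pseudovariety (pv_groups V)"
proof (rule pseudovarietyI)
  show "finite_semigroup S" if "S \<in> pv_groups V" for S
    using that by (simp add: pv_groups_def pv_G_def)
  show "T \<in> pv_groups V"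
    if "S \<in> pv_groups V" "finite_semigroup T" "h \<in> sg_hom S T" "h ` carrier S = carrier T" for S T h
  proof -
    have "semigroup_str S" "semigroup_str T" "group_on S (carrier S)"
      using that by (simp_all add: pv_groups_def pv_G_def finite_semigroup_def)
    then have "group_on T (carrier T)" using group_on_image[of S T h "carrier S"] that by simp
    moreover have "h \<in> osg_hom (discrete S) (discrete T)"
      using that(3) by (simp add: osg_hom_def sg_hom_def)
    ultimately show ?thesis
      using that finite_discrete[of T] opv_hom[OF V, of "discrete S" "discrete T" h]
      by (simp add: pv_groups_def pv_G_def)
  qed
  show "S\<lparr>carrier := A\<rparr> \<in> pv_groups V" if S: "S \<in> pv_groups V" and A: "subsemigroup A S" for S A
  proof -
    have sg: "semigroup_str S" and fin: "finite (carrier S)" and G: "group_on S (carrier S)"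
      using S by (simp_all add: pv_groups_def pv_G_def finite_semigroup_def)
    have AS: "A \<subseteq> carrier S" using A by (simp add: subsemigroup_def)
    have finA: "finite A" using AS fin finite_subset by blast
    obtain e where "normal_orthogroup S" "idempotents S = {e}"
      using G group_iff_unique_idempotent[OF sg] by blast
    moreover have "A \<inter> idempotents S \<noteq> {}" using ex_idempotent_subsemigroup[OF sg A finA] .
    ultimately have "normal_orthogroup (S\<lparr>carrier := A\<rparr>)" "idempotents (S\<lparr>carrier := A\<rparr>) = {e}"
      using normal_orthogroup_sub[OF _ A finA] idempotents_sub[OF AS] by auto
    then have "group_on (S\<lparr>carrier := A\<rparr>) A"
      using group_iff_unique_idempotent[OF subsemigroup_sgrp[OF sg A]] by simp
    moreover have "discrete (S\<lparr>carrier := A\<rparr>) \<in> V"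
      unfolding discrete_sub using S A by (intro opv_sub[OF V]) (simp_all add: pv_groups_def subsemigroup_def)
    ultimately show ?thesis
      using subsemigroup_sgrp[OF sg A] finA by (simp add: pv_groups_def pv_G_def finite_semigroup_def)
  qed
  show "T \<in> pv_groups V"
    if S: "\<And>i. i < n \<Longrightarrow> S i \<in> pv_groups V" and T: "finite_semigroup T"
      "h \<in> sg_iso (sg_prod {..<n} S) T" for n :: nat and S T h
  proof -
    let ?P = "osg_prod {..<n} (\<lambda>i. discrete (S i))"
    have sgT: "semigroup_str T" using T by (simp add: finite_semigroup_def)
    have bij: "bij_betw h (carrier ?P) (carrier T)" and hom: "h \<in> sg_hom ?P T"
      using T(2) by (simp_all add: sg_iso_def sg_hom_def sg_prod_def)
    have S': "semigroup_str (S i)" "group_on (S i) (carrier (S i))" if "i < n" for i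
      using S[OF that] by (simp_all add: pv_groups_def pv_G_def finite_semigroup_def)
    have "\<forall>i<n. normal_orthogroup (S i) \<and> (\<exists>e. idempotents (S i) = {e})"
      using S' group_iff_unique_idempotent by blast
    then obtain e where e: "\<And>i. i < n \<Longrightarrow> normal_orthogroup (S i) \<and> idempotents (S i) = {e i}" by metis
    have "normal_orthogroup ?P" using e by (intro normal_orthogroup_osg_prod) (simp add: discrete_iff)
    moreover have "idempotents ?P = {restrict e {..<n}}"
    proof -
      have "idempotents ?P = (\<Pi>\<^sub>E i\<in>{..<n}. {restrict e {..<n} i})"
        unfolding idempotents_osg_prod discrete_iff using e by (intro PiE_cong) simp
      then show ?thesis by (simp only: PiE_singleton restrict_extensional)
    qed
    moreover have "h ` carrier ?P = carrier T" using bij by (rule bij_betw_imp_surj_on)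
    ultimately have "group_on T (carrier T)" using unique_idempotent_hom[OF _ _ sgT hom] by blast
    moreover have "h \<in> osg_iso ?P (discrete T)"
    proof -
      have "x \<preceq>\<^bsub>?P\<^esub> y \<longleftrightarrow> h x = h y" if "x \<in> carrier ?P" "y \<in> carrier ?P" for x y
      proof -
        have "x \<preceq>\<^bsub>?P\<^esub> y \<longleftrightarrow> x = y" using that by (auto intro: PiE_ext)
        then show ?thesis using inj_on_eq_iff[OF bij_betw_imp_inj_on[OF bij] that] by simp
      qed
      moreover have "h \<in> sg_iso ?P (discrete T)" using hom bij by (simp add: sg_iso_def sg_hom_def)
      ultimately show ?thesis unfolding osg_iso_def by simp
    qed
    then have "discrete T \<in> V"
      using S by (intro opv_prod[OF V _ finite_discrete[OF T(1)]]) (auto simp: pv_groups_def)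
    ultimately show ?thesis using T(1) by (simp add: pv_groups_def pv_G_def)
  qed
qed

lemma ord_pseudovariety_NB: "ord_pseudovariety (with_all_orders \<N>\<B>)"
proof (rule ord_pseudovarietyI)
  show "finite_ord_semigroup S" if "S \<in> with_all_orders \<N>\<B>" for S
    using that by (simp add: with_all_orders_def)
  show "T \<in> with_all_orders \<N>\<B>"
    if "S \<in> with_all_orders \<N>\<B>" and T: "finite_ord_semigroup T" and "h \<in> osg_hom S T" and im: "h ` carrier S = carrier T" for S T h
  proof -
    have h: "h \<in> sg_hom S T" using that by (simp add: osg_hom_def)
    have NB: "normal_band S" using that by (simp add: with_all_orders_iff)
    then interpret sgrp S by (simp add: normal_band_def sgrp_def)
    have "normal_band T"
      using T NB unfolding normal_band_def im[symmetric]
      by (simp add: finite_ord_semigroup_def ord_semigroup_str_def flip: sg_hom_mult[OF h])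
    then show ?thesis using T by (simp add: with_all_orders_iff)
  qed
  show "S\<lparr>carrier := A\<rparr> \<in> with_all_orders \<N>\<B>" if S: "S \<in> with_all_orders \<N>\<B>" and A: "subsemigroup A S" for S A
  proof -
    have "A \<subseteq> carrier S" using A by (simp add: subsemigroup_def)
    then show ?thesis
      using S A finite_subsemigroup_ord[of S A] subsemigroup_sgrp[of S A]
      unfolding with_all_orders_iff normal_band_def by (simp add: subset_iff)
  qed
  show "T \<in> with_all_orders \<N>\<B>"
    if S: "\<And>i. i < n \<Longrightarrow> S i \<in> with_all_orders \<N>\<B>" and T: "finite_ord_semigroup T"
      and iso: "h \<in> osg_iso (osg_prod {..<n} S) T" for n :: nat and S T h
  proof -
    let ?P = "osg_prod {..<n} S"
    have h: "h \<in> sg_hom ?P T" using iso by (simp add: osg_iso_def sg_iso_def)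
    have im: "h ` carrier ?P = carrier T"
      using iso by (simp add: osg_iso_def sg_iso_def bij_betw_def)
    have NB: "normal_band (S i)" if "i < n" for i using S[OF that] by (simp add: with_all_orders_iff)
    have "semigroup_str ?P" using NB by (intro osg_prod_semigroup) (simp add: normal_band_def)
    then interpret sgrp ?P by (simp add: sgrp_def)
    have "x \<bullet>\<^bsub>?P\<^esub> x = x" if "x \<in> carrier ?P" for x
      using that NB by (auto simp: normal_band_def PiE_iff extensional_def restrict_def fun_eq_iff)
    moreover have "x \<bullet>\<^bsub>?P\<^esub> y \<bullet>\<^bsub>?P\<^esub> z \<bullet>\<^bsub>?P\<^esub> x = x \<bullet>\<^bsub>?P\<^esub> z \<bullet>\<^bsub>?P\<^esub> y \<bullet>\<^bsub>?P\<^esub> x"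
      if "x \<in> carrier ?P" "y \<in> carrier ?P" "z \<in> carrier ?P" for x y z
      using that NB by (auto simp: normal_band_def PiE_iff intro!: restrict_ext)
    ultimately have "normal_band T"
      using T unfolding normal_band_def im[symmetric]
      by (simp add: finite_ord_semigroup_def ord_semigroup_str_def del: osg_prod_simps flip: sg_hom_mult[OF h])
    then show ?thesis using T by (simp add: with_all_orders_iff)
  qed
qed

section \<open>Pseudovarieties with prescribed bands and groups\<close>

text \<open>With \<open>U = with_all_orders H\<close> this is the preimage of the pair
  \<open>(W, H)\<close> under the isomorphism. Quantifying over all subgroups, not only maximal
  ones, makes the condition on groups pass to subsemigroups at once.\<close>

definition orthogroups_over :: "nat ord_semigrp set \<Rightarrow> nat ord_semigrp set \<Rightarrow> nat ord_semigrp set" where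
  "orthogroups_over W U = {S. finite_ord_semigroup S \<and> normal_orthogroup S \<and>
     S\<lparr>carrier := idempotents S\<rparr> \<in> W \<and> (\<forall>K. group_on S K \<longrightarrow> S\<lparr>carrier := K\<rparr> \<in> U)}"

lemma orthogroups_overD:
  assumes "S \<in> orthogroups_over W U"
  shows "finite_ord_semigroup S" "normal_orthogroup S" "S\<lparr>carrier := idempotents S\<rparr> \<in> W"
    "group_on S K \<Longrightarrow> S\<lparr>carrier := K\<rparr> \<in> U"
  using assms unfolding orthogroups_over_def by blast+

lemma orthogroups_overI:
  assumes "finite_ord_semigroup S" "normal_orthogroup S" "S\<lparr>carrier := idempotents S\<rparr> \<in> W"
    "\<And>K. group_on S K \<Longrightarrow> S\<lparr>carrier := K\<rparr> \<in> U"
  shows "S \<in> orthogroups_over W U"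
  using assms unfolding orthogroups_over_def by blast

lemma osg_hom_restrict:
  assumes "h \<in> osg_hom S T" "A \<subseteq> carrier S" "h ` A \<subseteq> B"
  shows "h \<in> osg_hom (S\<lparr>carrier := A\<rparr>) (T\<lparr>carrier := B\<rparr>)"
  using assms unfolding osg_hom_def sg_hom_def by (auto simp: subset_iff)

lemma osg_iso_hom: "h \<in> osg_iso S T \<Longrightarrow> h \<in> osg_hom S T"
  by (simp add: osg_iso_def sg_iso_def osg_hom_def)

lemma osg_iso_image: "h \<in> osg_iso S T \<Longrightarrow> h ` carrier S = carrier T"
  by (simp add: osg_iso_def sg_iso_def bij_betw_def)

lemma osg_hom_sg_hom: "h \<in> osg_hom S T \<Longrightarrow> h \<in> sg_hom S T"
  by (simp add: osg_hom_def)

lemma ord_pseudovariety_orthogroups_over: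
  assumes W: "ord_pseudovariety W" and U: "ord_pseudovariety U"
  shows "ord_pseudovariety (orthogroups_over W U)"
proof (rule ord_pseudovarietyI)
  show "finite_ord_semigroup S" if "S \<in> orthogroups_over W U" for S
    using that by (rule orthogroups_overD)
next
  fix S T :: "nat ord_semigrp" and h
  assume S: "S \<in> orthogroups_over W U" and T: "finite_ord_semigroup T"
    and h: "h \<in> osg_hom S T" "h ` carrier S = carrier T"
  note hom = osg_hom_sg_hom[OF h(1)]
  interpret nocr S using orthogroups_overD(2)[OF S] by (simp add: nocr_def)
  have sgT: "semigroup_str T" using T by (simp add: finite_ord_semigroup_def ord_semigroup_str_def)
  have finS: "finite (carrier S)" using orthogroups_overD(1)[OF S] by (simp add: finite_ord_semigroup_def)
  have NO: "normal_orthogroup T" by (rule normal_orthogroup_hom[OF normal_orthogroup sgT hom h(2)])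
  then have sub: "subsemigroup (idempotents T) T" by (simp add: normal_orthogroup_def)
  have im: "h ` idempotents S = idempotents T"
    using lift_idempotent[OF hom h(2) sgT] sg_hom_idem[OF hom] by (fastforce simp: image_iff)
  show "T \<in> orthogroups_over W U"
  proof (rule orthogroups_overI[OF T NO])
    have "h \<in> osg_hom (S\<lparr>carrier := idempotents S\<rparr>) (T\<lparr>carrier := idempotents T\<rparr>)"
      using im by (intro osg_hom_restrict[OF h(1)]) auto
    then show "T\<lparr>carrier := idempotents T\<rparr> \<in> W"
      using opv_hom[OF W orthogroups_overD(3)[OF S] finite_subsemigroup_ord[OF T sub]] im by simp
  next
    fix K assume K: "group_on T K"
    then have "K \<subseteq> h ` carrier S" using h(2) by (simp add: group_on_def)
    then obtain L where L: "group_on S L" "h ` L = K"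
      using lift_group[OF semigroup_str finS sgT hom K] by blast
    have "h \<in> osg_hom (S\<lparr>carrier := L\<rparr>) (T\<lparr>carrier := K\<rparr>)"
      using L by (intro osg_hom_restrict[OF h(1)]) (auto simp: group_on_def)
    then show "T\<lparr>carrier := K\<rparr> \<in> U"
      using opv_hom[OF U orthogroups_overD(4)[OF S L(1)]
          finite_subsemigroup_ord[OF T group_on_subsemigroup[OF sgT K]]] L(2) by simp
  qed
next
  fix S A
  assume S: "S \<in> orthogroups_over W U" and A: "subsemigroup A S"
  interpret nocr S using orthogroups_overD(2)[OF S] by (simp add: nocr_def)
  have finS: "finite (carrier S)" using orthogroups_overD(1)[OF S] by (simp add: finite_ord_semigroup_def)
  have AS: "A \<subseteq> carrier S" and finA: "finite A"
    using A finS by (auto simp: subsemigroup_def intro: finite_subset)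
  show "S\<lparr>carrier := A\<rparr> \<in> orthogroups_over W U"
  proof (rule orthogroups_overI)
    show "finite_ord_semigroup (S\<lparr>carrier := A\<rparr>)"
      by (rule finite_subsemigroup_ord[OF orthogroups_overD(1)[OF S] A])
    show "normal_orthogroup (S\<lparr>carrier := A\<rparr>)" by (rule normal_orthogroup_sub[OF normal_orthogroup A finA])
    have "subsemigroup (A \<inter> idempotents S) (S\<lparr>carrier := idempotents S\<rparr>)"
      using A subsemigroup_idem ex_idempotent_subsemigroup[OF semigroup_str A finA]
      by (simp add: subsemigroup_def)
    from opv_sub[OF W orthogroups_overD(3)[OF S] this]
    show "S\<lparr>carrier := A, carrier := idempotents (S\<lparr>carrier := A\<rparr>)\<rparr> \<in> W"
      by (simp add: idempotents_sub[OF AS])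
    show "S\<lparr>carrier := A, carrier := K\<rparr> \<in> U" if "group_on (S\<lparr>carrier := A\<rparr>) K" for K
    proof -
      have "K \<subseteq> A" using that by (simp add: group_on_def)
      then have "group_on S K" using that group_on_restrict[OF _ AS] by blast
      then show ?thesis using orthogroups_overD(4)[OF S] by simp
    qed
  qed
next
  fix n :: nat and S and T :: "nat ord_semigrp" and h
  assume S: "\<And>i. i < n \<Longrightarrow> S i \<in> orthogroups_over W U" and T: "finite_ord_semigroup T"
    and iso: "h \<in> osg_iso (osg_prod {..<n} S) T"
  let ?P = "osg_prod {..<n} S"
  note h = osg_iso_hom[OF iso] and im = osg_iso_image[OF iso]
  note hom = osg_hom_sg_hom[OF h]
  have NP: "normal_orthogroup ?P" using orthogroups_overD(2)[OF S] by (intro normal_orthogroup_osg_prod) simp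
  then interpret nocr ?P by (simp add: nocr_def)
  have finP: "finite_ord_semigroup ?P" using orthogroups_overD(1)[OF S] by (intro osg_prod_finite_ord) simp_all
  have sgT: "semigroup_str T" using T by (simp add: finite_ord_semigroup_def ord_semigroup_str_def)
  have NO: "normal_orthogroup T" by (rule normal_orthogroup_hom[OF NP sgT hom im])
  then have sub: "subsemigroup (idempotents T) T" by (simp add: normal_orthogroup_def)
  show "T \<in> orthogroups_over W U"
  proof (rule orthogroups_overI[OF T NO])
    let ?E = "osg_prod {..<n} (\<lambda>i. S i\<lparr>carrier := idempotents (S i)\<rparr>)"
    have EP: "idempotents ?P \<subseteq> carrier ?P" unfolding idempotents_def by blast
    have imE: "h ` idempotents ?P = idempotents T"
    proof
      show "h ` idempotents ?P \<subseteq> idempotents T" using sg_hom_idem[OF hom] by blast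
      show "idempotents T \<subseteq> h ` idempotents ?P"
      proof
        fix f assume "f \<in> idempotents T"
        from lift_idempotent[OF hom im sgT this] show "f \<in> h ` idempotents ?P" by (elim bexE) (simp add: rev_image_eqI)
      qed
    qed
    have inj: "inj_on h (carrier ?P)" using iso by (simp add: osg_iso_def sg_iso_def bij_betw_def)
    have bij: "bij_betw h (idempotents ?P) (idempotents T)"
      using imE inj_on_subset[OF inj EP] by (simp add: bij_betw_def)
    have E: "carrier ?E = idempotents ?P" "sg_mult ?E = sg_mult ?P" "sg_le ?E = sg_le ?P"
      unfolding idempotents_osg_prod by (simp_all add: osg_prod_def)
    have "h x \<in> idempotents T" if "x \<in> idempotents ?P" for x using that imE by blast
    moreover have "h (x \<bullet>\<^bsub>?P\<^esub> y) = h x \<bullet>\<^bsub>T\<^esub> h y" "x \<preceq>\<^bsub>?P\<^esub> y \<longleftrightarrow> h x \<preceq>\<^bsub>T\<^esub> h y"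
      if "x \<in> idempotents ?P" "y \<in> idempotents ?P" for x y
      using sg_hom_mult[OF hom] iso that EP unfolding osg_iso_def by (blast, blast)
    ultimately have isoE: "h \<in> osg_iso ?E (T\<lparr>carrier := idempotents T\<rparr>)"
      using bij unfolding osg_iso_def sg_iso_def sg_hom_def E by (simp del: osg_prod_simps)
    have EW: "S i\<lparr>carrier := idempotents (S i)\<rparr> \<in> W" if "i < n" for i
      by (rule orthogroups_overD(3)[OF S[OF that]])
    show "T\<lparr>carrier := idempotents T\<rparr> \<in> W"
      by (rule opv_prod[where S = "\<lambda>i. S i\<lparr>carrier := idempotents (S i)\<rparr>",
            OF W EW finite_subsemigroup_ord[OF T sub] isoE])
  next
    fix K assume K: "group_on T K"
    have "K \<subseteq> h ` carrier ?P" using im K by (simp add: group_on_def)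
    then obtain L where L: "group_on ?P L" "h ` L = K"
      using lift_group[OF semigroup_str _ sgT hom K] finP by (auto simp: finite_ord_semigroup_def)
    have LP: "subsemigroup L ?P" by (rule group_on_subsemigroup[OF semigroup_str L(1)])
    \<comment> \<open>A subgroup of a product need not be a product of subgroups. It lies, however,
      in the product of its projections, which are subgroups of the factors; thus \<open>K\<close>
      is a divisor of a product of members of \<open>U\<close>.\<close>
    define R where "R i = S i\<lparr>carrier := (\<lambda>x. x i) ` L\<rparr>" for i
    have RU: "R i \<in> U" if "i < n" for i
      unfolding R_def
    proof (rule orthogroups_overD(4)[OF S[OF that]], rule group_on_image[OF semigroup_str _ _ L(1)])
      show "semigroup_str (S i)"
        using orthogroups_overD(2)[OF S[OF that]] by (simp add: normal_orthogroup_iff)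
      show "(\<lambda>x. x i) \<in> sg_hom ?P (S i)" using that by (auto simp: sg_hom_def PiE_iff)
    qed
    have R: "sg_mult (osg_prod {..<n} R) = sg_mult ?P" "sg_le (osg_prod {..<n} R) = sg_le ?P"
      by (simp_all add: osg_prod_def R_def)
    have "L \<subseteq> carrier (osg_prod {..<n} R)"
      using LP by (auto simp: subsemigroup_def R_def PiE_iff subset_iff)
    then have subL: "subsemigroup L (osg_prod {..<n} R)" using LP unfolding subsemigroup_def R by blast
    have homL: "h \<in> osg_hom ((osg_prod {..<n} R)\<lparr>carrier := L\<rparr>) (T\<lparr>carrier := K\<rparr>)"
    proof -
      have "h \<in> osg_hom (?P\<lparr>carrier := L\<rparr>) (T\<lparr>carrier := K\<rparr>)"
        using L LP by (intro osg_hom_restrict[OF h]) (auto simp: subsemigroup_def)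
      then show ?thesis unfolding osg_hom_def sg_hom_def by (simp add: R del: osg_prod_simps)
    qed
    show "T\<lparr>carrier := K\<rparr> \<in> U"
      by (rule opv_divisor[OF U RU finite_subsemigroup_ord[OF T group_on_subsemigroup[OF sgT K]] subL homL])
        (simp_all add: L(2))
  qed
qed

lemma ord_pseudovariety_finite: "ord_pseudovariety {S. finite_ord_semigroup S}"
  by (rule ord_pseudovarietyI) (auto intro: finite_subsemigroup_ord)

text \<open>Prescribing all finite ordered semigroups both for the bands and for the groups imposes
  no restriction, so the general closure result applies.\<close>

lemma ord_pseudovariety_NOCR: "ord_pseudovariety (with_all_orders \<N>\<O>\<C>\<R>)"
proof -
  have "with_all_orders \<N>\<O>\<C>\<R> = orthogroups_over {S. finite_ord_semigroup S} {S. finite_ord_semigroup S}"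
  proof -
    have "S \<in> orthogroups_over {S. finite_ord_semigroup S} {S. finite_ord_semigroup S}"
      if S: "finite_ord_semigroup S" "normal_orthogroup S" for S
    proof (rule orthogroups_overI[OF S])
      have sg: "semigroup_str S" using S by (simp add: normal_orthogroup_iff)
      show "S\<lparr>carrier := idempotents S\<rparr> \<in> {S. finite_ord_semigroup S}"
        using S finite_subsemigroup_ord[of S "idempotents S"] by (simp add: normal_orthogroup_def)
      show "S\<lparr>carrier := K\<rparr> \<in> {S. finite_ord_semigroup S}" if "group_on S K" for K
        using finite_subsemigroup_ord[OF S(1) group_on_subsemigroup[OF sg that]] by simp
    qed
    then show ?thesis by (auto simp: with_all_orders_iff dest: orthogroups_overD)
  qed
  then show ?thesis
    using ord_pseudovariety_orthogroups_over[OF ord_pseudovariety_finite ord_pseudovariety_finite] by simp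
qed

section \<open>Recovering the prescribed bands and groups, and comparing pseudovarieties by
  them\<close>

lemma normal_band_normal_orthogroup:
  assumes "normal_band S"
  shows "normal_orthogroup S" "idempotents S = carrier S"
proof -
  show E: "idempotents S = carrier S" using assms by (auto simp: idempotents_def normal_band_def)
  have "\<exists>y\<in>carrier S. x \<bullet>\<^bsub>S\<^esub> y = y \<bullet>\<^bsub>S\<^esub> x \<and> x \<bullet>\<^bsub>S\<^esub> y \<bullet>\<^bsub>S\<^esub> x = x" if "x \<in> carrier S" for x
    using assms that by (intro bexI[of _ x]) (simp_all add: normal_band_def)
  then show "normal_orthogroup S"
    using assms unfolding normal_orthogroup_iff E normal_band_def semigroup_str_def by blast
qed

text \<open>Subgroups of a band are trivial, and trivial semigroups lie in every pseudovariety, so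
  on bands only the condition involving \<open>W\<close> remains.\<close>

lemma orthogroups_over_bands:
  assumes W: "ord_pseudovariety W" "W \<subseteq> with_all_orders \<N>\<B>" and H: "pseudovariety H"
  shows "orthogroups_over W (with_all_orders H) \<inter> with_all_orders \<N>\<B> = W"
proof (intro Set.set_eqI iffI)
  fix S assume "S \<in> orthogroups_over W (with_all_orders H) \<inter> with_all_orders \<N>\<B>"
  then have "S\<lparr>carrier := idempotents S\<rparr> \<in> W" "normal_band S"
    using orthogroups_overD(3) by (auto simp: with_all_orders_iff)
  then show "S \<in> W" using normal_band_normal_orthogroup[of S] by simp
next
  fix S assume S: "S \<in> W"
  then have B: "finite_ord_semigroup S" "normal_band S" using W by (auto simp: with_all_orders_iff)
  note N = normal_band_normal_orthogroup[OF B(2)]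
  interpret nocr S using N by (simp add: nocr_def)
  have "S \<in> orthogroups_over W (with_all_orders H)"
  proof (rule orthogroups_overI[OF B(1) N(1)])
    show "S\<lparr>carrier := idempotents S\<rparr> \<in> W" using S N by simp
    fix K assume K: "group_on S K"
    obtain e where e: "e \<in> K" "e \<in> idempotents S" "K \<subseteq> units_at S e" using K by (rule group_on_sub_units_at)
    have "x = e" if "x \<in> K" for x
    proof -
      have x: "x \<in> units_at S e" "x \<in> idempotents S" using that e(3) N(2) by (auto elim: units_atE)
      show ?thesis using idem_part_eq[OF x(1) e(2)] idem_part_idem[OF x(2)] by simp
    qed
    then have "K = {e}" using e by blast
    moreover have "finite_ord_semigroup (S\<lparr>carrier := K\<rparr>)"
      by (rule finite_subsemigroup_ord[OF B(1) group_on_subsemigroup[OF semigroup_str K]])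
    ultimately show "S\<lparr>carrier := K\<rparr> \<in> with_all_orders H"
      using trivial_in_opv[OF ord_pseudovariety_with_all_orders[OF H]] by simp
  qed
  then show "S \<in> orthogroups_over W (with_all_orders H) \<inter> with_all_orders \<N>\<B>"
    using S W by blast
qed

text \<open>A group has a single idempotent, so its band is trivial and automatically in
  \<open>W\<close>. Conversely the whole group is one of its own subgroups, which forces it into
  \<open>H\<close>.\<close>

lemma orthogroups_over_groups:
  assumes W: "ord_pseudovariety W" and H: "pseudovariety H" "H \<subseteq> \<G>"
  shows "pv_groups (orthogroups_over W (with_all_orders H)) = H"
proof (intro Set.set_eqI iffI)
  fix G assume "G \<in> pv_groups (orthogroups_over W (with_all_orders H))"
  then have G: "group_on G (carrier G)" and D: "discrete G \<in> orthogroups_over W (with_all_orders H)"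
    by (simp_all add: pv_groups_def pv_G_def)
  have "(discrete G)\<lparr>carrier := carrier G\<rparr> \<in> with_all_orders H"
    by (rule orthogroups_overD(4)[OF D]) (simp add: discrete_iff G)
  then have "discrete G \<in> with_all_orders H" by (simp add: discrete_def)
  then show "G \<in> H" by (simp add: with_all_orders_def truncate_discrete)
next
  fix G assume G: "G \<in> H"
  then have GG: "G \<in> \<G>" and fin: "finite_semigroup G" and grp: "group_on G (carrier G)"
    using H by (auto simp: pv_G_def)
  have sg: "semigroup_str G" using fin by (simp add: finite_semigroup_def)
  obtain e where N: "normal_orthogroup G" and e: "idempotents G = {e}"
    using grp group_iff_unique_idempotent[OF sg] by blast
  have "discrete G \<in> orthogroups_over W (with_all_orders H)"
  proof (rule orthogroups_overI)
    show fD: "finite_ord_semigroup (discrete G)" by (rule finite_discrete[OF fin])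
    show ND: "normal_orthogroup (discrete G)" using N by (simp add: discrete_iff)
    have "finite_ord_semigroup ((discrete G)\<lparr>carrier := idempotents (discrete G)\<rparr>)"
      using ND by (intro finite_subsemigroup_ord[OF fD]) (simp add: normal_orthogroup_def)
    then show "(discrete G)\<lparr>carrier := idempotents (discrete G)\<rparr> \<in> W"
      using e by (intro trivial_in_opv[OF W, of _ e]) (simp_all add: discrete_iff)
    fix K assume "group_on (discrete G) K"
    then have sub: "subsemigroup K G" using group_on_subsemigroup[OF sg] by (simp add: discrete_iff)
    have "finite_ord_semigroup ((discrete G)\<lparr>carrier := K\<rparr>)"
      using sub by (intro finite_subsemigroup_ord[OF fD]) (simp add: discrete_iff)
    then show "(discrete G)\<lparr>carrier := K\<rparr> \<in> with_all_orders H"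
      using pv_sub[OF H(1) G sub] by (simp add: with_all_orders_def truncate_sub truncate_discrete)
  qed
  then show "G \<in> pv_groups (orthogroups_over W (with_all_orders H))" using GG by (simp add: pv_groups_def)
qed

text \<open>The given order on the finite group is equality, so the identity map is isotone in both
  directions.\<close>

lemma discrete_in_opv_iff:
  assumes V: "ord_pseudovariety V" and S: "finite_ord_semigroup S" and G: "group_on S (carrier S)"
  shows "discrete (semigrp.truncate S) \<in> V \<longleftrightarrow> S \<in> V"
proof -
  let ?D = "discrete (semigrp.truncate S)"
  have eq: "x \<preceq>\<^bsub>S\<^esub> y \<longleftrightarrow> x = y" if "x \<in> carrier S" "y \<in> carrier S" for x y
    using ord_group_discrete[OF S G that] ord_le_refl[of S] S that by (auto simp: finite_ord_semigroup_def)
  have sg: "semigroup_str S" using S by (simp add: finite_ord_semigroup_def ord_semigroup_str_def)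
  have D: "finite_ord_semigroup ?D"
    using finite_ord_semigroup_finite[OF S] by (intro finite_discrete) simp
  have "(\<lambda>x. x) \<in> osg_hom S ?D" "(\<lambda>x. x) \<in> osg_hom ?D S"
    using sg eq by (simp_all add: osg_hom_def sg_hom_def semigroup_str_def)
  then show ?thesis using opv_hom[OF V _ D] opv_hom[OF V _ S] by (metis image_ident discrete_simps(1) truncate_simps(1))
qed

text \<open>Each member of \<open>V\<close> yields its band and its maximal subgroups as
  subsemigroups in \<open>V\<close>. The assumption moves these into \<open>V'\<close>, where
  \<open>nocr_in_opv\<close> reassembles the member.\<close>

lemma opv_subset_iff:
  assumes V: "ord_pseudovariety V" "V \<subseteq> with_all_orders \<N>\<O>\<C>\<R>" and V': "ord_pseudovariety V'"
  shows "V \<subseteq> V' \<longleftrightarrow> V \<inter> with_all_orders \<N>\<B> \<subseteq> V' \<inter> with_all_orders \<N>\<B> \<and> pv_groups V \<subseteq> pv_groups V'"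
    (is "_ \<longleftrightarrow> ?B \<and> ?G")
proof
  show "V \<subseteq> V' \<Longrightarrow> ?B \<and> ?G" by (auto simp: pv_groups_def)
next
  assume *: "?B \<and> ?G"
  show "V \<subseteq> V'"
  proof
    fix S assume S: "S \<in> V"
    then have fin: "finite_ord_semigroup S" and NO: "normal_orthogroup S"
      using V by (auto simp: with_all_orders_iff)
    interpret nocr S using NO by (simp add: nocr_def)
    show "S \<in> V'"
    proof (rule nocr_in_opv[OF V' fin NO])
      have "S\<lparr>carrier := idempotents S\<rparr> \<in> V" by (rule opv_sub[OF V(1) S subsemigroup_idem])
      moreover have "S\<lparr>carrier := idempotents S\<rparr> \<in> with_all_orders \<N>\<B>"
        using NO finite_subsemigroup_ord[OF fin subsemigroup_idem]
        by (simp add: with_all_orders_iff normal_orthogroup_def)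
      ultimately show "S\<lparr>carrier := idempotents S\<rparr> \<in> V'" using * by blast
    next
      fix e assume "e \<in> idempotents S"
      then have grp: "group_on S (units_at S e)" by (rule group_on_units_at)
      let ?H = "S\<lparr>carrier := units_at S e\<rparr>"
      have sub: "subsemigroup (units_at S e) S" by (rule group_on_subsemigroup[OF semigroup_str grp])
      have H: "?H \<in> V" by (rule opv_sub[OF V(1) S sub])
      have finH: "finite_ord_semigroup ?H" by (rule finite_subsemigroup_ord[OF fin sub])
      have grpH: "group_on ?H (carrier ?H)"
        using grp sub group_on_restrict[of "units_at S e" "units_at S e" S] by (simp add: subsemigroup_def)
      have "discrete (semigrp.truncate ?H) \<in> V" using discrete_in_opv_iff[OF V(1) finH grpH] H by blast
      moreover have "semigrp.truncate ?H \<in> \<G>"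
        using finite_ord_semigroup_finite[OF finH] grpH by (simp add: pv_G_def)
      ultimately have "discrete (semigrp.truncate ?H) \<in> V'" using * by (auto simp: pv_groups_def)
      then show "?H \<in> V'" using discrete_in_opv_iff[OF V' finH grpH] by blast
    qed
  qed
qed

section \<open>Lattices of pseudovarieties\<close>

lemma partial_order_inclusion: "partial_order \<lparr>carrier = C, eq = (=), le = (\<subseteq>)\<rparr>"
  by unfold_locales auto

lemma partial_order_prod_gorder:
  assumes "partial_order L" "partial_order M"
  shows "partial_order (L \<times>\<^sub>L M)"
proof -
  interpret L: partial_order L by fact
  interpret M: partial_order M by fact
  show ?thesis
    by unfold_locales
      (auto simp: prod_gorder_def intro: L.le_antisym M.le_antisym L.le_trans M.le_trans)
qed

lemma lattice_ord_pv_lattice: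
  assumes top: "ord_pseudovariety (with_all_orders U)"
  shows "lattice (\<L>\<^sub>o U)"
proof -
  interpret partial_order "\<L>\<^sub>o U" unfolding ord_pv_lattice_def by (rule partial_order_inclusion)
  show ?thesis
  proof
    fix V W assume V: "V \<in> carrier (\<L>\<^sub>o U)" and W: "W \<in> carrier (\<L>\<^sub>o U)"
    \<comment> \<open>The join is the intersection of all upper bounds; the pseudovariety of all
      admissible members keeps this family nonempty.\<close>
    define \<V> where "\<V> = {X. ord_pseudovariety X \<and> X \<subseteq> with_all_orders U \<and> V \<subseteq> X \<and> W \<subseteq> X}"
    have mem: "with_all_orders U \<in> \<V>" using V W top by (auto simp: \<V>_def ord_pv_lattice_def)
    have "ord_pseudovariety (\<Inter>\<V>)" using mem by (intro ord_pseudovariety_Inter) (auto simp: \<V>_def)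
    then have "least (\<L>\<^sub>o U) (\<Inter>\<V>) (Upper (\<L>\<^sub>o U) {V, W})"
      using mem V W by (auto simp: least_def Upper_def ord_pv_lattice_def \<V>_def)
    then show "\<exists>s. least (\<L>\<^sub>o U) s (Upper (\<L>\<^sub>o U) {V, W})" ..
    have "greatest (\<L>\<^sub>o U) (V \<inter> W) (Lower (\<L>\<^sub>o U) {V, W})"
      using V W ord_pseudovariety_Int by (auto simp: greatest_def Lower_def ord_pv_lattice_def)
    then show "\<exists>s. greatest (\<L>\<^sub>o U) s (Lower (\<L>\<^sub>o U) {V, W})" ..
  qed
qed

text \<open>An order isomorphism transports least upper and greatest lower bounds, so
  \<open>M\<close> inherits the lattice property from \<open>L\<close>. For the direct product it
  then suffices to know a partial order.\<close>

lemma lattice_isomorphicI: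
  assumes L: "lattice L" and M: "partial_order M"
    and f: "bij_betw f (carrier L) (carrier M)"
    and le: "\<And>x y. x \<in> carrier L \<Longrightarrow> y \<in> carrier L \<Longrightarrow> x \<sqsubseteq>\<^bsub>L\<^esub> y \<longleftrightarrow> f x \<sqsubseteq>\<^bsub>M\<^esub> f y"
  shows "L \<cong>\<^sub>L M"
proof -
  interpret L: lattice L by fact
  interpret M: partial_order M by fact
  have fM: "f x \<in> carrier M" if "x \<in> carrier L" for x using f that by (auto simp: bij_betw_def)
  have fL: "\<exists>x \<in> carrier L. u = f x" if "u \<in> carrier M" for u using f that by (auto simp: bij_betw_def)
  have sup: "least M (f s) (Upper M {f x, f y})"
    if "least L s (Upper L {x, y})" "x \<in> carrier L" "y \<in> carrier L" for x y s
  proof -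
    have "s \<in> carrier L" using that by (auto simp: least_def)
    then show ?thesis
      using that fM unfolding least_def Upper_def by (auto simp: le dest!: fL)
  qed
  have inf: "greatest M (f s) (Lower M {f x, f y})"
    if "greatest L s (Lower L {x, y})" "x \<in> carrier L" "y \<in> carrier L" for x y s
  proof -
    have "s \<in> carrier L" using that by (auto simp: greatest_def)
    then show ?thesis
      using that fM unfolding greatest_def Lower_def by (auto simp: le dest!: fL)
  qed
  interpret M: lattice M
  proof
    fix u v assume uv: "u \<in> carrier M" "v \<in> carrier M"
    then obtain x y where xy: "x \<in> carrier L" "y \<in> carrier L" "u = f x" "v = f y" using fL by meson
    show "\<exists>s. least M s (Upper M {u, v})" using L.sup_of_two_exists[OF xy(1,2)] sup xy by blast
    show "\<exists>s. greatest M s (Lower M {u, v})" using L.inf_of_two_exists[OF xy(1,2)] inf xy by blast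
  qed
  have "f (x \<squnion>\<^bsub>L\<^esub> y) = f x \<squnion>\<^bsub>M\<^esub> f y" if xy: "x \<in> carrier L" "y \<in> carrier L" for x y
  proof (rule L.joinI[OF _ xy], rule M.joinI[OF _ fM[OF xy(1)] fM[OF xy(2)]])
    fix s t assume "least L s (Upper L {x, y})" "least M t (Upper M {f x, f y})"
    then show "f s = t" using sup[OF _ xy] M.least_unique by blast
  qed
  moreover have "f (x \<sqinter>\<^bsub>L\<^esub> y) = f x \<sqinter>\<^bsub>M\<^esub> f y" if xy: "x \<in> carrier L" "y \<in> carrier L" for x y
  proof (rule L.meetI[OF _ xy], rule M.meetI[OF _ fM[OF xy(1)] fM[OF xy(2)]])
    fix s t assume "greatest L s (Lower L {x, y})" "greatest M t (Lower M {f x, f y})"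
    then show "f s = t" using inf[OF _ xy] M.greatest_unique by blast
  qed
  ultimately show ?thesis
    unfolding lattice_isomorphic_def join_pres_def meet_pres_def
    using f L M.lattice_axioms by blast
qed

theorem theorem2:
  shows "\<L>\<^sub>o \<N>\<O>\<C>\<R> \<cong>\<^sub>L \<L>\<^sub>o \<N>\<B> \<times>\<^sub>L \<L> \<G>"
proof (rule lattice_isomorphicI)
  let ?f = "\<lambda>V. (V \<inter> with_all_orders \<N>\<B>, pv_groups V)"
  show "lattice (\<L>\<^sub>o \<N>\<O>\<C>\<R>)" by (rule lattice_ord_pv_lattice[OF ord_pseudovariety_NOCR])
  show "partial_order (\<L>\<^sub>o \<N>\<B> \<times>\<^sub>L \<L> \<G>)"
    unfolding ord_pv_lattice_def pv_lattice_def
    by (intro partial_order_prod_gorder partial_order_inclusion)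
  \<comment> \<open>This single equivalence gives both the preservation and reflection of the order
    and, by antisymmetry, injectivity.\<close>
  have iff: "V \<subseteq> V' \<longleftrightarrow> V \<inter> with_all_orders \<N>\<B> \<subseteq> V' \<inter> with_all_orders \<N>\<B> \<and> pv_groups V \<subseteq> pv_groups V'"
    if "V \<in> carrier (\<L>\<^sub>o \<N>\<O>\<C>\<R>)" "V' \<in> carrier (\<L>\<^sub>o \<N>\<O>\<C>\<R>)" for V V'
    using that by (intro opv_subset_iff) (simp_all add: ord_pv_lattice_def)
  then show "V \<sqsubseteq>\<^bsub>\<L>\<^sub>o \<N>\<O>\<C>\<R>\<^esub> V' \<longleftrightarrow> ?f V \<sqsubseteq>\<^bsub>\<L>\<^sub>o \<N>\<B> \<times>\<^sub>L \<L> \<G>\<^esub> ?f V'"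
    if "V \<in> carrier (\<L>\<^sub>o \<N>\<O>\<C>\<R>)" "V' \<in> carrier (\<L>\<^sub>o \<N>\<O>\<C>\<R>)" for V V'
    using that by (simp add: prod_gorder_def pv_lattice_def ord_pv_lattice_def)
  show "bij_betw ?f (carrier (\<L>\<^sub>o \<N>\<O>\<C>\<R>)) (carrier (\<L>\<^sub>o \<N>\<B> \<times>\<^sub>L \<L> \<G>))"
    unfolding bij_betw_def
  proof (intro conjI equalityI)
    show "inj_on ?f (carrier (\<L>\<^sub>o \<N>\<O>\<C>\<R>))"
    proof (rule inj_onI)
      fix V V'
      assume V: "V \<in> carrier (\<L>\<^sub>o \<N>\<O>\<C>\<R>)" "V' \<in> carrier (\<L>\<^sub>o \<N>\<O>\<C>\<R>)" and "?f V = ?f V'"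
      then show "V = V'" using iff[OF V] iff[OF V(2,1)] by (intro equalityI) simp_all
    qed
    show "?f ` carrier (\<L>\<^sub>o \<N>\<O>\<C>\<R>) \<subseteq> carrier (\<L>\<^sub>o \<N>\<B> \<times>\<^sub>L \<L> \<G>)"
      using ord_pseudovariety_Int[OF _ ord_pseudovariety_NB] pseudovariety_pv_groups
      by (auto simp: prod_gorder_def ord_pv_lattice_def pv_lattice_def pv_groups_def)
    show "carrier (\<L>\<^sub>o \<N>\<B> \<times>\<^sub>L \<L> \<G>) \<subseteq> ?f ` carrier (\<L>\<^sub>o \<N>\<O>\<C>\<R>)"
    proof
      fix p assume "p \<in> carrier (\<L>\<^sub>o \<N>\<B> \<times>\<^sub>L \<L> \<G>)"
      then obtain W H where p: "p = (W, H)" and W: "ord_pseudovariety W" "W \<subseteq> with_all_orders \<N>\<B>"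
        and H: "pseudovariety H" "H \<subseteq> \<G>"
        by (auto simp: prod_gorder_def ord_pv_lattice_def pv_lattice_def)
      let ?V = "orthogroups_over W (with_all_orders H)"
      have "ord_pseudovariety ?V"
        by (rule ord_pseudovariety_orthogroups_over[OF W(1) ord_pseudovariety_with_all_orders[OF H(1)]])
      moreover have "?V \<subseteq> with_all_orders \<N>\<O>\<C>\<R>" by (auto simp: with_all_orders_iff dest: orthogroups_overD)
      ultimately have "?V \<in> carrier (\<L>\<^sub>o \<N>\<O>\<C>\<R>)" by (simp add: ord_pv_lattice_def)
      moreover have "?f ?V = p"
        using p orthogroups_over_bands[OF W H(1)] orthogroups_over_groups[OF W(1) H] by simp
      ultimately show "p \<in> ?f ` carrier (\<L>\<^sub>o \<N>\<O>\<C>\<R>)" by (rule image_eqI[OF sym, rotated])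
    qed
  qed
qed

end
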